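(* Let $(n_{k})_{k\ge 0}$ be a strictly increasing sequence of integers. Suppose that the set $$C=\{\lambda\in\mathbb{T} : \lambda^{n_{k}}\to 1 \text{ as } k\to+\infty\}$$ is dense in $\mathbb{T}$. Then $(n_{k})_{k\ge 1}$ is a rigidity sequence.
   Context: $\mathbb{T}=\{\lambda\in\mathbb{C} : |\lambda|=1\}$. Let $(X,\mathcal{B},m;T)$ be an invertible measure-preserving dynamical system on a (non-trivial, i.e. not reduced to one atom) Borel probability space, with Koopman operator $U_{T}f=f\circ T$ on $L^{2}(X,\mathcal{B},m)$. The system is rigid with respect to a strictly increasing sequence of integers $(n_{k})_{k\ge 1}$ if $\|U_{T}^{n_{k}}f-f\|\to 0$ as $k\to+\infty$ for every $f\in L^{2}(X,\mathcal{B},m)$. A strictly increasing sequence of integers $(n_{k})_{k\ge 1}$ is called a rigidity sequence if there exists a weakly mixing system which is rigid with respect to $(n_{k})_{k\ge 1}$. It is a known fact that this is equivalent to the existence of a Borel probability measure $\mu$ on $\mathbb{T}$ without atoms such that $\widehat{\mu}(n_{k})\to 1$ as $k\to+\infty$, where $\widehat{\mu}(n)=\int_{\mathbb{T}}\lambda^{n}\,d\mu(\lambda)$. *)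

theory Defs
  imports "HOL-Probability.Probability"
begin

definition iter_int :: "('b \<Rightarrow> 'b) \<Rightarrow> int \<Rightarrow> 'b \<Rightarrow> 'b" where
  "iter_int F n = (if 0 \<le> n then F ^^ nat n else inv F ^^ nat (- n))"

definition koopman :: "('a \<Rightarrow> 'a) \<Rightarrow> ('a \<Rightarrow> complex) \<Rightarrow> ('a \<Rightarrow> complex)" where
  "koopman T f = f \<circ> T"

lemma iter_int_koopman:
  assumes "bij T"
  shows "iter_int (koopman T) n f = f \<circ> iter_int T n"
proof -
  have pow: "(koopman S ^^ k) f = f \<circ> (S ^^ k)" for S :: "'a \<Rightarrow> 'a" and k
    by (induction k) (simp_all add: koopman_def o_assoc funpow_swap1 fun_eq_iff)
  have "inv (koopman T) = koopman (inv T)"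
    using assms
    by (intro inv_unique_comp)
       (simp_all add: fun_eq_iff koopman_def bij_is_inj bij_is_surj surj_f_inv_f)
  then show ?thesis
    by (simp add: iter_int_def pow)
qed

text \<open>
  Square-integrable functions are represented by functions rather than by classes modulo
  almost everywhere equality.
\<close>

definition L2_fun :: "'a measure \<Rightarrow> ('a \<Rightarrow> complex) set" where
  "L2_fun M = {f \<in> borel_measurable M. integrable M (\<lambda>x. (cmod (f x))\<^sup>2)}"

definition L2_norm :: "'a measure \<Rightarrow> ('a \<Rightarrow> complex) \<Rightarrow> real" where
  "L2_norm M f = sqrt (LINT x|M. (cmod (f x))\<^sup>2)"

text \<open>
  The assumption \<open>nontrivial\<close> says that the space is not reduced to one atom of the measure.
\<close>

locale measure_preserving_system = prob_space M
  for M :: "'a::polish_space measure" and T :: "'a \<Rightarrow> 'a" +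
  assumes sets_borel: "sets M = sets borel"
    and nontrivial: "\<exists>A\<in>sets M. 0 < measure M A \<and> measure M A < 1"
    and bij: "bij T"
    and measurable_T: "T \<in> measurable M M"
    and measurable_inv_T: "inv T \<in> measurable M M"
    and preserving: "distr M M T = M"

definition weakly_mixing :: "'a measure \<Rightarrow> ('a \<Rightarrow> 'a) \<Rightarrow> bool" where
  "weakly_mixing M T \<longleftrightarrow>
    (\<forall>A\<in>sets M. \<forall>B\<in>sets M.
      (\<lambda>N. (\<Sum>j<N. \<bar>measure M ((T ^^ j) -` A \<inter> B) - measure M A * measure M B\<bar>) / real N)
        \<longlonglongrightarrow> 0)"

definition rigid_wrt :: "'a measure \<Rightarrow> ('a \<Rightarrow> 'a) \<Rightarrow> (nat \<Rightarrow> int) \<Rightarrow> bool" where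
  "rigid_wrt M T n \<longleftrightarrow>
    (\<forall>f\<in>L2_fun M. (\<lambda>k. L2_norm M (\<lambda>x. iter_int (koopman T) (n k) f x - f x)) \<longlonglongrightarrow> 0)"

text \<open>
  HOL cannot quantify existentially over the type of the underlying space, so the system is
  sought on the sequence space \<open>nat \<Rightarrow> real\<close> with its product topology. This is no
  restriction: every Polish space is homeomorphic to a closed subset of this one, and a system
  is transported to it by taking the image measure and extending the transformation by the
  identity outside the image, which is a null set.
\<close>

definition rigidity_sequence :: "(nat \<Rightarrow> int) \<Rightarrow> bool" where
  "rigidity_sequence n \<longleftrightarrow> strict_mono n \<and>
    (\<exists>(M :: (nat \<Rightarrow> real) measure) T.
      measure_preserving_system M T \<and> weakly_mixing M T \<and> rigid_wrt M T n)"

end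

theory Submission
  imports Defs "HOL-Real_Asymp.Real_Asymp"
begin

text \<open>
  Choose points \<open>l\<^sub>j\<close> of \<open>C\<close> tending to 1 very rapidly and form the infinite convolution of the
  measures giving mass \<open>1 - w\<^sub>j\<close> to 1 and mass \<open>w\<^sub>j = 1 / (j + 2)\<close> to \<open>l\<^sub>j\<close>. Its Fourier
  coefficients are the products of the factors \<open>1 - w\<^sub>j + w\<^sub>j l\<^sub>j\<^sup>m\<close>. Along \<open>m = n\<^sub>k\<close> all factors but one are very close to 1,
  and the exceptional one is within \<open>2 w\<^sub>j\<close> of 1, so the coefficients tend to 1; since the
  weights \<open>w\<^sub>j\<close> are not summable, the mean square of the coefficients vanishes (no atoms).
  The shift on the stationary Gaussian process with this covariance is the required system:
  on the span of the functions \<open>exp (i f)\<close> with \<open>f\<close> linear, which is dense in \<open>L\<^sup>1\<close>, mixing and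
  rigidity are read off from the covariance.
\<close>

section \<open>Positive definite sequences from Riesz-type products\<close>

text \<open>Two demands on the weights pull apart: convergence to 1 along \<open>n k\<close> needs
  them to tend to 0, while a summable choice would leave an atom. The value
  \<open>1 / (j + 2)\<close> meets both, stays at most 1/2, and makes the product of the numbers
  \<open>1 - weight j\<close> telescope.

  The measure on the circle is never built. Only its coefficient sequence enters, as a limit of
  products, and positive definiteness and decay of the mean square are shown on the products
  themselves. The Cesaro form of weak mixing needs no more than that decay.

  Density of \<open>C\<close> is used at 1, to pick each point close to 1 and outside a finite set
  of resonances with the earlier points. Without this avoidance the means of the squares need not
  multiply, and the non-summability of the weights could not be exploited.

  A Gaussian process suits because its covariance determines everything: correlations of
  exponentials of linear functionals are bounded by covariances, and the squared increment of a
  coordinate has mean \<open>2 - 2 * r (n k)\<close>. The process is real, so the real part of the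
  coefficients is taken.\<close>

definition weight :: "nat \<Rightarrow> real" where
  "weight j = 1 / (real j + 2)"

definition riesz_factor :: "(nat \<Rightarrow> complex) \<Rightarrow> nat \<Rightarrow> int \<Rightarrow> complex" where
  "riesz_factor l j m = of_real (1 - weight j) + of_real (weight j) * l j powi m"

definition riesz_prod :: "(nat \<Rightarrow> complex) \<Rightarrow> nat \<Rightarrow> int \<Rightarrow> complex" where
  "riesz_prod l p m = (\<Prod>j<p. riesz_factor l j m)"

lemma weight_bounds: "0 < weight j" "weight j \<le> 1/2"
  by (auto simp: weight_def divide_simps)

lemma norm_powi_unit: "norm w = 1 \<Longrightarrow> norm (w powi m) = 1" for w :: complex
  by (simp add: norm_power_int)

lemma powi_plus_unit: "norm w = 1 \<Longrightarrow> w powi (m + c) = w powi m * w powi c" for w :: complex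
  by (intro power_int_add) auto

lemma cnj_powi_unit: "norm w = 1 \<Longrightarrow> cnj (w powi m) = w powi (- m)" for w :: complex
proof -
  assume w: "norm w = 1"
  then have "w * cnj w = 1" by (simp add: complex_norm_square[symmetric])
  then have "cnj w = inverse w" using w
    by (metis inverse_unique)
  then have "cnj (w powi m) = inverse w powi m"
    by (cases "m \<ge> 0") (auto simp: power_int_def)
  then show ?thesis by (simp add: power_int_inverse power_int_minus)
qed

lemma norm_riesz_factor_le:
  assumes "norm (l j) = 1"
  shows "norm (riesz_factor l j m) \<le> 1"
proof -
  have "norm (riesz_factor l j m) \<le> (1 - weight j) + weight j * norm (l j powi m)"
    unfolding riesz_factor_def
    using weight_bounds[of j] by (intro order.trans[OF norm_triangle_ineq]) (simp add: norm_mult del: of_real_diff)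
  then show ?thesis using assms by (simp add: norm_powi_unit)
qed

lemma norm_riesz_factor_diff:
  "norm (riesz_factor l j m - 1) = weight j * norm (l j powi m - 1)"
proof -
  have "riesz_factor l j m - 1 = of_real (weight j) * (l j powi m - 1)"
    by (simp add: riesz_factor_def algebra_simps)
  then show ?thesis using weight_bounds[of j] by (simp add: norm_mult)
qed

text \<open>On the unit circle the square is affine in the real part of the power, so its constant
  term is its mean as soon as the powers of \<open>l j\<close> average to 0.\<close>

lemma norm_riesz_factor_square:
  assumes "norm (l j) = 1"
  shows "(norm (riesz_factor l j m))\<^sup>2 = 1 - 2 * weight j * (1 - weight j) + 2 * weight j * (1 - weight j) * Re (l j powi m)"
proof -
  define z where "z = l j powi m"
  have "norm z = 1" using assms by (simp add: z_def norm_powi_unit)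
  then have 1: "(Re z)\<^sup>2 + (Im z)\<^sup>2 = 1" by (simp add: cmod_power2[symmetric])
  have "(norm (riesz_factor l j m))\<^sup>2 = (1 - weight j + weight j * Re z)\<^sup>2 + (weight j * Im z)\<^sup>2"
    unfolding riesz_factor_def z_def[symmetric] cmod_power2 by simp
  also have "\<dots> = (1 - weight j)\<^sup>2 + 2 * weight j * (1 - weight j) * Re z + (weight j)\<^sup>2 * ((Re z)\<^sup>2 + (Im z)\<^sup>2)"
    by (simp add: power2_eq_square algebra_simps)
  also have "\<dots> = 1 - 2 * weight j * (1 - weight j) + 2 * weight j * (1 - weight j) * Re z"
    unfolding 1 by (simp add: power2_eq_square algebra_simps)
  finally show ?thesis by (simp add: z_def)
qed

lemma norm_riesz_prod_le:
  assumes "\<And>j. norm (l j) = 1"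
  shows "norm (riesz_prod l p m) \<le> 1"
  unfolding riesz_prod_def by (rule norm_prod_le[THEN order.trans]) (intro prod_le_1 conjI norm_ge_zero norm_riesz_factor_le assms)

text \<open>Factors in the closed unit disc do not amplify errors, so the errors of the individual
  factors simply add.\<close>

lemma norm_riesz_prod_diff:
  assumes "\<And>j. norm (l j) = 1"
  shows "norm (riesz_prod l p m - 1) \<le> (\<Sum>j<p. weight j * norm (l j powi m - 1))"
  unfolding riesz_prod_def norm_riesz_factor_diff[symmetric]
  using norm_prod_diff[of "{..<p}" "\<lambda>j. riesz_factor l j m" "\<lambda>_. 1"] norm_riesz_factor_le[of l, OF assms] by simp

section \<open>Cesaro means and finite spectra of the partial products\<close>

definition mean_to :: "(int \<Rightarrow> complex) \<Rightarrow> complex \<Rightarrow> bool" where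
  "mean_to g a \<longleftrightarrow> (\<forall>c. (\<lambda>N. (\<Sum>j<N. g (int j + c)) / of_nat N) \<longlonglongrightarrow> a)"

lemma mean_to_add: "mean_to f a \<Longrightarrow> mean_to g b \<Longrightarrow> mean_to (\<lambda>m. f m + g m) (a + b)"
  unfolding mean_to_def by (auto simp: sum.distrib add_divide_distrib intro!: tendsto_intros)

lemma mean_to_mult: "mean_to f a \<Longrightarrow> mean_to (\<lambda>m. b * f m) (b * a)"
  unfolding mean_to_def
  by (auto simp: sum_distrib_left[symmetric] times_divide_eq_right[symmetric] simp del: times_divide_eq_right intro!: tendsto_intros)

lemma mean_to_cnj: "mean_to f a \<Longrightarrow> mean_to (\<lambda>m. cnj (f m)) (cnj a)"
  unfolding mean_to_def using tendsto_cnj by fastforce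

lemma mean_to_const: "mean_to (\<lambda>m. a) a"
  unfolding mean_to_def
proof
  show "(\<lambda>N. (\<Sum>j<N. a) / of_nat N) \<longlonglongrightarrow> a"
    by (rule tendsto_eventually) (use eventually_gt_at_top[of 0] in eventually_elim, simp)
qed

lemma mean_to_powi:
  assumes "norm w = 1" "w \<noteq> 1"
  shows "mean_to (\<lambda>m. w powi m) 0"
  unfolding mean_to_def
proof
  fix c
  have "(\<lambda>N. 2 / norm (1 - w) / real N) \<longlonglongrightarrow> 0"
    by real_asymp
  moreover have "norm ((\<Sum>j<N. w powi (int j + c)) / of_nat N) \<le> 2 / norm (1 - w) / real N" for N
  proof -
    have "(\<Sum>j<N. w powi (int j + c)) = w powi c * (\<Sum>j<N. w ^ j)"
      using assms by (simp add: powi_plus_unit sum_distrib_left mult.commute)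
    also have "\<dots> = w powi c * ((1 - w ^ N) / (1 - w))"
      using assms by (simp add: sum_gp_strict)
    finally have "norm (\<Sum>j<N. w powi (int j + c)) = norm (1 - w ^ N) / norm (1 - w)"
      using assms by (simp add: norm_mult norm_divide norm_powi_unit)
    also have "\<dots> \<le> 2 / norm (1 - w)"
      using norm_triangle_ineq4[of 1 "w ^ N"] assms by (intro divide_right_mono) (auto simp: norm_power)
    finally show ?thesis
      by (simp only: norm_divide norm_of_nat divide_right_mono of_nat_0_le_iff)
  qed
  ultimately show "(\<lambda>N. (\<Sum>j<N. w powi (int j + c)) / of_nat N) \<longlonglongrightarrow> 0"
    by (metis (mono_tags, lifting) Lim_null_comparison eventually_sequentiallyI)
qed

text \<open>
  Choosing \<open>l\<^sub>p\<close> outside the finite spectrum of the square of the \<open>p\<close>-th partial product makes the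
  mean of the next square the product of the means, as for independent factors.
\<close>

definition finite_spectrum :: "(int \<Rightarrow> complex) \<Rightarrow> bool" where
  "finite_spectrum g \<longleftrightarrow> (\<exists>F. finite F \<and> (\<forall>w. norm w = 1 \<longrightarrow> w \<notin> F \<longrightarrow> mean_to (\<lambda>m. g m * w powi m) 0))"

lemma finite_spectrum_1: "finite_spectrum (\<lambda>m. 1)"
  unfolding finite_spectrum_def by (intro exI[of _ "{1}"]) (simp add: mean_to_powi)

lemma finite_spectrum_add:
  assumes "finite_spectrum f" "finite_spectrum g"
  shows "finite_spectrum (\<lambda>m. f m + g m)"
proof -
  obtain F G where "finite F" "\<forall>w. norm w = 1 \<longrightarrow> w \<notin> F \<longrightarrow> mean_to (\<lambda>m. f m * w powi m) 0"
    "finite G" "\<forall>w. norm w = 1 \<longrightarrow> w \<notin> G \<longrightarrow> mean_to (\<lambda>m. g m * w powi m) 0"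
    using assms unfolding finite_spectrum_def by blast
  then show ?thesis unfolding finite_spectrum_def
    using mean_to_add[of _ 0 _ 0]
    by (intro exI[of _ "F \<union> G"]) (auto simp: ring_distribs)
qed

lemma finite_spectrum_mult:
  assumes "finite_spectrum f"
  shows "finite_spectrum (\<lambda>m. b * f m)"
  using assms mean_to_mult[of _ 0 b] unfolding finite_spectrum_def
  by (metis (no_types, lifting) ext mult.assoc mult_zero_right)

text \<open>Multiplication by the powers of \<open>v\<close> rotates the spectrum: the exceptional
  set \<open>F\<close> becomes \<open>F\<close> divided by \<open>v\<close>.\<close>

lemma finite_spectrum_powi:
  assumes f: "finite_spectrum f" and v: "norm v = 1"
  shows "finite_spectrum (\<lambda>m. f m * v powi m)"
proof -
  obtain F where F: "finite F" "\<And>w. norm w = 1 \<Longrightarrow> w \<notin> F \<Longrightarrow> mean_to (\<lambda>m. f m * w powi m) 0"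
    using f unfolding finite_spectrum_def by blast
  have "mean_to (\<lambda>m. f m * v powi m * w powi m) 0" if "norm w = 1" "w \<notin> (\<lambda>u. u / v) ` F" for w
  proof -
    have "v * w \<notin> F"
    proof
      assume "v * w \<in> F"
      moreover have "w = (v * w) / v" using v by auto
      ultimately show False using that by blast
    qed
    then show ?thesis using F(2)[of "v * w"] that v
      by (simp add: norm_mult power_int_mult_distrib mult.assoc)
  qed
  then show ?thesis unfolding finite_spectrum_def using F(1) by blast
qed

definition riesz_square :: "(nat \<Rightarrow> complex) \<Rightarrow> nat \<Rightarrow> int \<Rightarrow> complex" where
  "riesz_square l p m = of_real ((norm (riesz_prod l p m))\<^sup>2)"

text \<open>The real part of a unit number is half the sum of it and its inverse, so a new factor
  produces one scaled copy of the old square and two rotated ones.\<close>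

lemma riesz_square_Suc:
  assumes "norm (l p) = 1"
  shows "riesz_square l (Suc p) m =
    of_real (1 - 2 * weight p * (1 - weight p)) * riesz_square l p m
    + of_real (weight p * (1 - weight p)) * (riesz_square l p m * l p powi m)
    + of_real (weight p * (1 - weight p)) * (riesz_square l p m * inverse (l p) powi m)"
proof -
  have "of_real (Re (l p powi m)) = (l p powi m + inverse (l p) powi m) / 2"
    using cnj_powi_unit[OF assms, of m] complex_add_cnj[of "l p powi m"]
    by (simp add: power_int_inverse power_int_minus)
  moreover have "riesz_square l (Suc p) m = riesz_square l p m * of_real ((norm (riesz_factor l p m))\<^sup>2)"
    by (simp add: riesz_square_def riesz_prod_def norm_mult power_mult_distrib)
  ultimately show ?thesis
    unfolding norm_riesz_factor_square[of l p, OF assms]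
    by (simp add: algebra_simps)
qed

lemma finite_spectrum_riesz_square:
  assumes "\<And>j. j < p \<Longrightarrow> norm (l j) = 1"
  shows "finite_spectrum (riesz_square l p)"
  using assms
proof (induction p)
  case 0
  then show ?case using finite_spectrum_1 by (simp add: riesz_square_def riesz_prod_def)
next
  case (Suc p)
  then show ?case
    unfolding riesz_square_Suc[of l p, OF Suc.prems[OF lessI], abs_def]
    by (intro finite_spectrum_add finite_spectrum_mult finite_spectrum_powi) (auto simp: norm_inverse)
qed

text \<open>Both rotated terms have mean 0, the second by conjugation because the square is real.
  Each step thus multiplies the mean by \<open>1 - 2 * weight p * (1 - weight p)\<close>, which is
  at most \<open>1 - weight p\<close> since the weight is at most 1/2, and the product of the latter
  telescopes to \<open>1 / (p + 1)\<close>.\<close>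

lemma mean_riesz_square:
  assumes "\<And>j. norm (l j) = 1"
    and "\<And>p. mean_to (\<lambda>m. riesz_square l p m * l p powi m) 0"
  shows "\<exists>a. mean_to (riesz_square l p) (of_real a) \<and> 0 \<le> a \<and> a \<le> 1 / (real p + 1)"
proof (induction p)
  case 0
  then show ?case using mean_to_const[of 1] by (intro exI[of _ 1]) (simp add: riesz_square_def riesz_prod_def)
next
  case (Suc p)
  then obtain a where a: "mean_to (riesz_square l p) (of_real a)" "0 \<le> a" "a \<le> 1 / (real p + 1)"
    by blast
  have "mean_to (\<lambda>m. cnj (riesz_square l p m * l p powi m)) (cnj 0)"
    using assms(2) by (rule mean_to_cnj)
  then have "mean_to (\<lambda>m. riesz_square l p m * inverse (l p) powi m) 0"
    by (simp add: riesz_square_def cnj_powi_unit assms power_int_inverse power_int_minus del: complex_cnj_power_int)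
  note mean_to_add[OF mean_to_add[OF mean_to_mult[OF a(1)] mean_to_mult[OF assms(2)]] mean_to_mult[OF this]]
  then have mean: "mean_to (riesz_square l (Suc p)) (of_real ((1 - 2 * weight p * (1 - weight p)) * a))"
    unfolding riesz_square_Suc[of l p, OF assms(1), abs_def] by (simp only: mult_zero_right add_0_right of_real_mult)
  have "1 - 2 * weight p * (1 - weight p) \<le> 1 - weight p"
    using weight_bounds[of p] by (simp add: mult_le_cancel_left)
  then have "(1 - 2 * weight p * (1 - weight p)) * a \<le> (1 - weight p) * (1 / (real p + 1))"
    using a weight_bounds[of p] by (intro mult_mono) auto
  moreover have "(1 - weight p) * (1 / (real p + 1)) = 1 / (real (Suc p) + 1)"
    by (simp add: weight_def divide_simps algebra_simps)
  ultimately have le: "(1 - 2 * weight p * (1 - weight p)) * a \<le> 1 / (real (Suc p) + 1)"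
    by simp
  have "2 * weight p * (1 - weight p) \<le> 1"
    using mult_mono[of "weight p" "1/2" "1 - weight p" 1] weight_bounds[of p] by simp
  then have "0 \<le> (1 - 2 * weight p * (1 - weight p)) * a"
    using a by simp
  then show ?case using mean le by blast
qed

section \<open>Choice of the rotations near 1\<close>

text \<open>The circle is perfect, so 1 is a limit point of the closure of \<open>C\<close>, hence
  of \<open>C\<close>, and it remains one after finitely many points are removed.\<close>

lemma dense_circle_avoids_finite:
  fixes C :: "complex set"
  assumes dense: "sphere 0 1 \<subseteq> closure C" and C: "C \<subseteq> sphere 0 1" and "finite F" "0 < d"
  shows "\<exists>w\<in>C. w \<notin> F \<and> norm (w - 1) < d"
proof -
  have lim: "(1::complex) islimpt sphere 0 1"
  proof (rule connected_imp_perfect)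
    show "sphere (0::complex) 1 \<noteq> {a}" for a
    proof
      assume "sphere (0::complex) 1 = {a}"
      moreover have "1 \<in> sphere (0::complex) 1" "-1 \<in> sphere (0::complex) 1" by auto
      ultimately show False by (metis neg_equal_zero one_neq_neg_one singletonD)
    qed
  qed (auto intro!: connected_sphere)
  have "1 islimpt closure C"
    using lim dense islimpt_subset by blast
  then have "1 islimpt C" by (simp add: limpt_of_closure)
  then have "1 islimpt (C - F)"
    using islimpt_Un_finite[OF \<open>finite F\<close>, of 1 "C - F"] by (metis Un_Diff_cancel islimpt_Un)
  then show ?thesis
    using \<open>0 < d\<close> unfolding islimpt_approachable by (force simp: dist_norm)
qed

lemma powi_near_1:
  assumes "finite A" "0 < e"
  shows "\<exists>d>0. \<forall>w::complex. norm (w - 1) < d \<longrightarrow> (\<forall>m\<in>A. norm (w powi m - 1) < e)"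
proof -
  have "\<forall>m\<in>A. \<forall>\<^sub>F w::complex in nhds 1. dist (w powi m) 1 < e"
  proof
    fix m
    have "((\<lambda>w::complex. w powi m) \<longlongrightarrow> 1 powi m) (nhds 1)"
      by (intro tendsto_power_int filterlim_ident) auto
    then show "\<forall>\<^sub>F w::complex in nhds 1. dist (w powi m) 1 < e"
      using assms(2) by (auto dest: tendstoD)
  qed
  then have "\<forall>\<^sub>F w::complex in nhds 1. \<forall>m\<in>A. dist (w powi m) 1 < e"
    using assms(1) by (intro eventually_ball_finite) auto
  then show ?thesis unfolding eventually_nhds_metric dist_norm by blast
qed

text \<open>
  From time \<open>K p\<close> on, the rotations \<open>l\<^sub>j\<close> with \<open>j < p\<close> are close to 1, and \<open>l\<^sub>p\<close> is then chosen so
  close to 1 that nothing is visible before \<open>K p\<close>: at each time at most one rotation is uncontrolled.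
\<close>

lemma exists_rotations:
  fixes n :: "nat \<Rightarrow> int"
  assumes dense: "sphere (0::complex) 1 \<subseteq> closure {z \<in> sphere 0 1. (\<lambda>k. z powi n k) \<longlonglongrightarrow> 1}"
  obtains l :: "nat \<Rightarrow> complex" and K :: "nat \<Rightarrow> nat"
  where "\<And>j. norm (l j) = 1"
    and "\<And>p. mean_to (\<lambda>m. riesz_square l p m * l p powi m) 0"
    and "\<And>p m. \<bar>m\<bar> \<le> int p \<Longrightarrow> norm (l p powi m - 1) \<le> (1/2) ^ p"
    and "\<And>p. p \<le> K p"
    and "\<And>p k. k < K p \<Longrightarrow> norm (l p powi n k - 1) \<le> (1/2) ^ p"
    and "\<And>p k j. K p \<le> k \<Longrightarrow> j < p \<Longrightarrow> norm (l j powi n k - 1) \<le> (1/2) ^ p"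
proof -
  define C where "C = {z \<in> sphere (0::complex) 1. (\<lambda>k. z powi n k) \<longlonglongrightarrow> 1}"
  \<comment> \<open>The clause \<open>p \<le> K\<close> forces the thresholds to infinity, so that
    every time lies beyond only finitely many of them.\<close>
  define good where "good f p K \<longleftrightarrow> p \<le> K \<and> (\<forall>k\<ge>K. \<forall>j<p. norm (f j powi n k - 1) \<le> (1/2) ^ p)"
    for f :: "nat \<Rightarrow> complex" and p K :: nat
  \<comment> \<open>The least threshold is a function of the earlier rotations alone; the dependent
    choice below requires that \<open>P f p\<close> look only at \<open>f j\<close> with
    \<open>j < p\<close>.\<close>
  define KK where "KK f p = (LEAST K. good f p K)" for f p
  define P where "P f p r \<longleftrightarrow> r \<in> C \<and> mean_to (\<lambda>m. riesz_square f p m * r powi m) 0 \<and>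
    (\<forall>m. \<bar>m\<bar> \<le> int p \<or> (\<exists>k<KK f p. m = n k) \<longrightarrow> norm (r powi m - 1) \<le> (1/2) ^ p)" for f p r
  have good: "good f p (KK f p)" if "\<And>j. j < p \<Longrightarrow> f j \<in> C" for f p
  proof -
    have "\<forall>j\<in>{..<p}. \<forall>\<^sub>F k in sequentially. dist (f j powi n k) 1 < (1/2) ^ p"
      using that by (intro ballI tendstoD) (auto simp: C_def)
    then have "\<forall>\<^sub>F k in sequentially. \<forall>j\<in>{..<p}. dist (f j powi n k) 1 < (1/2) ^ p"
      by (intro eventually_ball_finite) auto
    then obtain K where "\<forall>k\<ge>K. \<forall>j\<in>{..<p}. dist (f j powi n k) 1 < (1/2) ^ p"
      unfolding eventually_sequentially by blast
    then have "good f p (max K p)" unfolding good_def by (force simp: dist_norm less_imp_le)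
    then show ?thesis unfolding KK_def by (rule LeastI)
  qed
  have "\<exists>l. \<forall>p. P l p (l p)"
  proof (rule dependent_wf_choice[OF wf_less_than])
    fix f g :: "nat \<Rightarrow> complex" and p r
    assume eq: "\<And>j. (j, p) \<in> less_than \<Longrightarrow> f j = g j"
    have "good f p = good g p" unfolding good_def fun_eq_iff using eq by auto
    moreover have "riesz_square f p = riesz_square g p"
      unfolding riesz_square_def riesz_prod_def riesz_factor_def fun_eq_iff using eq by auto
    ultimately show "P f p r = P g p r" unfolding P_def KK_def by simp
  next
    fix p f assume f: "\<And>j. (j, p) \<in> less_than \<Longrightarrow> P f j (f j)"
    then have fC: "f j \<in> C" if "j < p" for j using that by (auto simp: P_def)
    then have "finite_spectrum (riesz_square f p)"
      by (intro finite_spectrum_riesz_square) (auto simp: C_def)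
    then obtain F where F: "finite F" "\<And>w. norm w = 1 \<Longrightarrow> w \<notin> F \<Longrightarrow> mean_to (\<lambda>m. riesz_square f p m * w powi m) 0"
      unfolding finite_spectrum_def by blast
    \<comment> \<open>The exponents at which \<open>l p\<close> must be invisible: a growing window
      around 0, which makes the product converge at every exponent, and the values
      \<open>n k\<close> before the threshold set by the earlier rotations.\<close>
    define A where "A = {- int p..int p} \<union> n ` {..<KK f p}"
    have "finite A" by (simp add: A_def)
    then obtain d where d: "d > 0" "\<And>w m. norm (w - 1) < d \<Longrightarrow> m \<in> A \<Longrightarrow> norm (w powi m - 1 :: complex) < (1/2) ^ p"
      using powi_near_1[of A "(1/2) ^ p"] by auto
    obtain w where w: "w \<in> C" "w \<notin> F" "norm (w - 1) < d"
      using dense_circle_avoids_finite[OF dense[folded C_def] _ F(1) d(1)] by (force simp: C_def)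
    have "P f p w"
      unfolding P_def
    proof (intro conjI allI impI)
      show "w \<in> C" by fact
      then show "mean_to (\<lambda>m. riesz_square f p m * w powi m) 0"
        using F(2) w(2) by (simp add: C_def)
      fix m assume "\<bar>m\<bar> \<le> int p \<or> (\<exists>k<KK f p. m = n k)"
      then have "m \<in> A" by (auto simp: A_def)
      then show "norm (w powi m - 1) \<le> (1/2) ^ p"
        by (intro less_imp_le d(2)[OF w(3)])
    qed
    then show "\<exists>w. P f p w" ..
  qed
  then obtain l where l: "\<And>p. P l p (l p)" by blast
  then have lC: "l j \<in> C" for j by (auto simp: P_def)
  then have K: "good l p (KK l p)" for p by (intro good)
  show thesis
  proof (rule that[of l "KK l"])
    show "norm (l j) = 1" for j using lC[of j] by (simp add: C_def)
    show "mean_to (\<lambda>m. riesz_square l p m * l p powi m) 0" for p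
      using l[of p] unfolding P_def by blast
    show "norm (l p powi m - 1) \<le> (1/2) ^ p" if "\<bar>m\<bar> \<le> int p" for p m
      using l[of p] that unfolding P_def by blast
    show "p \<le> KK l p" for p
      using K[of p] unfolding good_def by blast
    show "norm (l p powi n k - 1) \<le> (1/2) ^ p" if "k < KK l p" for p k
      using l[of p] that unfolding P_def by blast
    show "norm (l j powi n k - 1) \<le> (1/2) ^ p" if "KK l p \<le> k" "j < p" for p k j
      using K[of p] that unfolding good_def by blast
  qed
qed

section \<open>The infinite product: convergence, means, positivity and limit along the
  sequence\<close>

definition riesz :: "(nat \<Rightarrow> complex) \<Rightarrow> int \<Rightarrow> complex" where
  "riesz l m = lim (\<lambda>p. riesz_prod l p m)"

text \<open>From \<open>p = |m|\<close> on, the factor of index \<open>p\<close> is within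
  \<open>(1/2) ^ p\<close> of 1 while the earlier product has modulus at most 1, so the increments
  are dominated by a geometric series.\<close>

lemma riesz_prod_tendsto:
  assumes l: "\<And>j. norm (l j) = 1"
    and near: "\<And>p m. \<bar>m\<bar> \<le> int p \<Longrightarrow> norm (l p powi m - 1) \<le> (1/2) ^ p"
  shows "(\<lambda>p. riesz_prod l p m) \<longlonglongrightarrow> riesz l m"
proof -
  have "summable (\<lambda>p. riesz_prod l (Suc p) m - riesz_prod l p m)"
  proof (rule summable_comparison_test')
    show "summable (\<lambda>p. (1/2::real) ^ p)" by (rule summable_geometric) simp
    fix p assume "p \<ge> nat \<bar>m\<bar>"
    then have "norm (l p powi m - 1) \<le> (1/2) ^ p" by (intro near) simp
    have "norm (riesz_prod l (Suc p) m - riesz_prod l p m) = norm (riesz_prod l p m) * norm (riesz_factor l p m - 1)"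
      by (simp add: riesz_prod_def norm_mult[symmetric] algebra_simps)
    also have "\<dots> \<le> 1 * (1 * norm (l p powi m - 1))"
      unfolding norm_riesz_factor_diff using norm_riesz_prod_le[of l, OF l] weight_bounds[of p]
      by (intro mult_mono) auto
    also have "\<dots> \<le> (1/2) ^ p" using \<open>norm (l p powi m - 1) \<le> (1/2) ^ p\<close> by simp
    finally show "norm (riesz_prod l (Suc p) m - riesz_prod l p m) \<le> (1/2) ^ p" .
  qed
  then have "(\<lambda>p. \<Sum>i<p. riesz_prod l (Suc i) m - riesz_prod l i m) \<longlonglongrightarrow> (\<Sum>i. riesz_prod l (Suc i) m - riesz_prod l i m)"
    by (rule summable_LIMSEQ)
  then have "convergent (\<lambda>p. riesz_prod l p m - riesz_prod l 0 m)"
    unfolding sum_lessThan_telescope[of "\<lambda>i. riesz_prod l i m"] convergent_def by blast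
  then have "convergent (\<lambda>p. riesz_prod l p m)"
    by (simp add: convergent_diff_const_right_iff)
  then show ?thesis unfolding riesz_def by (simp add: convergent_LIMSEQ_iff)
qed

text \<open>The moduli of the partial products decrease. This domination is what carries mean
  squares to the limit, where exchanging the limit in \<open>p\<close> with the Cesaro limit would
  not be justified by itself.\<close>

lemma norm_riesz_le_prod:
  assumes l: "\<And>j. norm (l j) = 1"
    and lim: "(\<lambda>p. riesz_prod l p m) \<longlonglongrightarrow> riesz l m"
  shows "norm (riesz l m) \<le> norm (riesz_prod l p m)"
proof (rule tendsto_upperbound[OF tendsto_norm[OF lim]])
  have "norm (riesz_prod l (p + i) m) \<le> norm (riesz_prod l p m)" for i
  proof (induction i)
    case (Suc i)
    have "norm (riesz_prod l (p + Suc i) m) = norm (riesz_prod l (p + i) m) * norm (riesz_factor l (p + i) m)"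
      by (simp add: riesz_prod_def norm_mult)
    also have "\<dots> \<le> norm (riesz_prod l (p + i) m)"
      using norm_riesz_factor_le[of l "p + i"] l by (simp add: mult_left_le)
    finally show ?case using Suc by simp
  qed simp
  then show "\<forall>\<^sub>F q in sequentially. norm (riesz_prod l q m) \<le> norm (riesz_prod l p m)"
    unfolding eventually_sequentially by (metis le_iff_add)
qed simp

text \<open>This is Wiener's criterion for the absence of atoms: the sequence is dominated by the
  partial product of index \<open>p\<close>, whose mean square is at most
  \<open>1 / (p + 1)\<close>. The offset \<open>c\<close> is kept because the covariance of two
  coordinates of the process will be \<open>r\<close> at the time plus the difference of their
  indices.\<close>

lemma mean_riesz:
  assumes l: "\<And>j. norm (l j) = 1"
    and mean: "\<And>p. mean_to (\<lambda>m. riesz_square l p m * l p powi m) 0"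
    and lim: "\<And>m. (\<lambda>p. riesz_prod l p m) \<longlonglongrightarrow> riesz l m"
  shows "(\<lambda>N. (\<Sum>j<N. (norm (riesz l (int j + c)))\<^sup>2) / real N) \<longlonglongrightarrow> 0"
proof (rule LIMSEQ_I)
  fix e :: real assume "0 < e"
  then obtain p where p: "1 / (real p + 1) < e"
    using reals_Archimedean[of e] by (auto simp: inverse_eq_divide add.commute)
  obtain a where a: "mean_to (riesz_square l p) (of_real a)" "0 \<le> a" "a \<le> 1 / (real p + 1)"
    using mean_riesz_square[of l p] l mean by blast
  define S where "S N = (\<Sum>j<N. (norm (riesz_prod l p (int j + c)))\<^sup>2) / real N" for N
  have "(\<lambda>N. Re ((\<Sum>j<N. riesz_square l p (int j + c)) / of_nat N)) \<longlonglongrightarrow> Re (of_real a)"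
    using a(1) unfolding mean_to_def by (intro tendsto_Re) auto
  moreover have "Re ((\<Sum>j<N. riesz_square l p (int j + c)) / of_nat N) = S N" for N
    by (simp add: riesz_square_def S_def del: of_real_power)
  ultimately have "S \<longlonglongrightarrow> a" by simp
  then have "\<forall>\<^sub>F N in sequentially. S N < e"
    by (rule order_tendstoD) (use a(3) p in simp)
  then obtain M where M: "\<And>N. N \<ge> M \<Longrightarrow> S N < e"
    unfolding eventually_sequentially by blast
  have nonneg: "0 \<le> (\<Sum>j<N. (norm (riesz l (int j + c)))\<^sup>2) / real N" for N by (simp add: sum_nonneg)
  have le: "(\<Sum>j<N. (norm (riesz l (int j + c)))\<^sup>2) / real N \<le> S N" for N
    unfolding S_def using norm_riesz_le_prod[of l, OF l lim]
    by (intro divide_right_mono sum_mono power_mono) auto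
  show "\<exists>no. \<forall>N\<ge>no. norm ((\<Sum>j<N. (norm (riesz l (int j + c)))\<^sup>2) / real N - 0) < e"
    using order.strict_trans1[OF le M] nonneg by (intro exI[of _ M] allI impI) (simp add: sum_nonneg)
qed

lemma mean_abs_of_mean_square:
  fixes a :: "nat \<Rightarrow> real"
  assumes "(\<lambda>N. (\<Sum>j<N. (a j)\<^sup>2) / real N) \<longlonglongrightarrow> 0"
  shows "(\<lambda>N. (\<Sum>j<N. \<bar>a j\<bar>) / real N) \<longlonglongrightarrow> 0"
proof (rule tendsto_sandwich[of "\<lambda>_. 0"])
  show "(\<lambda>N. sqrt ((\<Sum>j<N. (a j)\<^sup>2) / real N)) \<longlonglongrightarrow> 0"
    using tendsto_real_sqrt[OF assms] by simp
  show "\<forall>\<^sub>F N in sequentially. (\<Sum>j<N. \<bar>a j\<bar>) / real N \<le> sqrt ((\<Sum>j<N. (a j)\<^sup>2) / real N)"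
    using eventually_gt_at_top[of 0]
  proof eventually_elim
    case (elim N)
    have "(\<Sum>j<N. \<bar>a j\<bar>)\<^sup>2 \<le> (\<Sum>j<N. (a j)\<^sup>2) * real N"
      using Cauchy_Schwarz_ineq_sum[of "\<lambda>j. \<bar>a j\<bar>" "\<lambda>j. 1" "{..<N}"] by simp
    then have "((\<Sum>j<N. \<bar>a j\<bar>) / real N)\<^sup>2 \<le> (\<Sum>j<N. (a j)\<^sup>2) / real N"
      using elim by (simp add: power_divide divide_simps power2_eq_square)
    then show ?case by (rule real_le_rsqrt)
  qed
qed (auto simp: sum_nonneg)

text \<open>The last factor is a convex combination of 1 and a character, which splits the form into
  two forms of the shorter product, one at \<open>t\<close> and one at the twisted vector
  \<open>t a * l p powi a\<close>. Hence the induction ranges over all \<open>t\<close>.\<close>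

lemma riesz_prod_positive:
  assumes l: "\<And>j. norm (l j) = 1" and "finite A"
  shows "0 \<le> Re (\<Sum>a\<in>A. \<Sum>b\<in>A. t a * cnj (t b) * riesz_prod l p (a - b))"
proof (induction p arbitrary: t)
  case 0
  have "(\<Sum>a\<in>A. \<Sum>b\<in>A. t a * cnj (t b) * riesz_prod l 0 (a - b)) = (\<Sum>a\<in>A. t a) * cnj (\<Sum>a\<in>A. t a)"
    by (simp add: riesz_prod_def sum_product)
  also have "\<dots> = of_real ((norm (\<Sum>a\<in>A. t a))\<^sup>2)" by (simp only: complex_norm_square)
  finally show ?case by simp
next
  case (Suc p)
  define s where "s a = t a * l p powi a" for a
  have st: "s a * cnj (s b) = t a * cnj (t b) * l p powi (a - b)" for a b
    unfolding s_def diff_conv_add_uminus powi_plus_unit[OF l] complex_cnj_mult cnj_powi_unit[OF l] by simp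
  have "t a * cnj (t b) * riesz_prod l (Suc p) (a - b) =
      of_real (1 - weight p) * (t a * cnj (t b) * riesz_prod l p (a - b)) + of_real (weight p) * (s a * cnj (s b) * riesz_prod l p (a - b))" for a b
    unfolding st by (simp add: riesz_prod_def riesz_factor_def algebra_simps)
  then have "(\<Sum>a\<in>A. \<Sum>b\<in>A. t a * cnj (t b) * riesz_prod l (Suc p) (a - b)) =
      of_real (1 - weight p) * (\<Sum>a\<in>A. \<Sum>b\<in>A. t a * cnj (t b) * riesz_prod l p (a - b)) +
      of_real (weight p) * (\<Sum>a\<in>A. \<Sum>b\<in>A. s a * cnj (s b) * riesz_prod l p (a - b))"
    by (simp add: sum.distrib sum_distrib_left del: of_real_diff)
  then show ?case using Suc[of t] Suc[of s] weight_bounds[of p] by (simp del: of_real_diff Re_sum)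
qed

lemma riesz_tendsto_1:
  assumes l: "\<And>j. norm (l j) = 1"
    and lim: "\<And>m. (\<lambda>p. riesz_prod l p m) \<longlonglongrightarrow> riesz l m"
    and K: "\<And>p. p \<le> K p"
    and below: "\<And>p k. k < K p \<Longrightarrow> norm (l p powi n k - 1) \<le> (1/2) ^ p"
    and above: "\<And>p k j. K p \<le> k \<Longrightarrow> j < p \<Longrightarrow> norm (l j powi n k - 1) \<le> (1/2) ^ p"
  shows "(\<lambda>k. riesz l (n k)) \<longlonglongrightarrow> 1"
proof (rule LIMSEQ_I)
  fix e :: real assume "0 < e"
  \<comment> \<open>The three terms bound the \<open>q\<close> factors before stage
    \<open>q\<close>, the factor \<open>q\<close> itself, and the geometric tail after it.\<close>
  define B where "B q = real q * (1/2) ^ q + 2 * weight q + 2 * (1/2) ^ q" for q :: nat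
  have "B \<longlonglongrightarrow> 0" unfolding B_def weight_def by real_asymp
  then obtain Q where Q: "\<And>q. q \<ge> Q \<Longrightarrow> B q < e"
    using order_tendstoD(2)[of B 0 sequentially e] \<open>0 < e\<close> unfolding eventually_sequentially by blast
  have "norm (riesz l (n k) - 1) < e" if k: "k \<ge> K Q" for k
  proof -
    define A where "A = {q. K q \<le> k}"
    have "A \<subseteq> {..k}" unfolding A_def using K le_trans by blast
    then have fin: "finite A" by (rule finite_subset) simp
    \<comment> \<open>The last stage whose threshold has been passed at time \<open>k\<close>:
      smaller indices are controlled by \<open>above\<close>, larger ones by
      \<open>below\<close>.\<close>
    define q where "q = Max A"
    have "Q \<in> A" using k by (simp add: A_def)
    then have "q \<in> A" unfolding q_def by (intro Max_in fin) auto
    then have q: "K q \<le> k" by (simp add: A_def)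
    have Qq: "Q \<le> q" unfolding q_def using \<open>Q \<in> A\<close> by (rule Max_ge[OF fin])
    have gt: "k < K j" if "j > q" for j
    proof (rule ccontr)
      assume "\<not> k < K j"
      then have "j \<in> A" by (simp add: A_def)
      then have "j \<le> q" unfolding q_def by (rule Max_ge[OF fin])
      then show False using that by simp
    qed
    define c where "c j = weight j * norm (l j powi n k - 1)" for j
    have w: "c j \<le> norm (l j powi n k - 1)" for j
      unfolding c_def using weight_bounds[of j] by (simp add: mult_left_le_one_le)
    have c1: "(\<Sum>j<q. c j) \<le> (\<Sum>j<q. (1/2) ^ q)"
      by (intro sum_mono order.trans[OF w] above[OF q]) simp
    have c2: "c q \<le> weight q * 2"
      unfolding c_def using weight_bounds[of q] norm_triangle_ineq4[of "l q powi n k" 1] l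
      by (intro mult_left_mono) (auto simp: norm_powi_unit)
    have c3: "(\<Sum>j\<in>{Suc q..<p}. c j) \<le> 2 * (1/2) ^ q" for p
    proof -
      have "(\<Sum>j\<in>{Suc q..<p}. c j) \<le> (\<Sum>j\<in>{Suc q..<p}. (1/2) ^ j)"
        by (intro sum_mono order.trans[OF w] below[OF gt]) simp
      also have "\<dots> \<le> (\<Sum>j\<in>{q..<q+p}. (1/2) ^ j)" by (intro sum_mono2) auto
      also have "\<dots> = (1/2) ^ q * (\<Sum>j<p. (1/2) ^ j)"
        using sum.shift_bounds_nat_ivl[of "\<lambda>j. (1/2::real) ^ j" 0 q p]
        by (simp add: sum_distrib_left power_add mult.commute lessThan_atLeast0 add.commute)
      also have "(\<Sum>j<p. (1/2::real) ^ j) \<le> 2" by (simp add: sum_gp_strict)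
      finally show ?thesis by simp
    qed
    have le: "(\<Sum>j<q. c j) + c q + (\<Sum>j\<in>{Suc q..<p}. c j) \<le> B q" for p
      using add_mono[OF add_mono[OF c1 c2] c3[of p]] by (simp add: B_def mult.commute)
    have "norm (riesz_prod l p (n k) - 1) \<le> B q" if "p > q" for p
    proof -
      have "(\<Sum>j<p. c j) = (\<Sum>j<q. c j) + c q + (\<Sum>j\<in>{Suc q..<p}. c j)"
        using that sum.atLeastLessThan_concat[of 0 q p c] by (simp add: lessThan_atLeast0 sum.atLeast_Suc_lessThan)
      then show ?thesis using le[of p] norm_riesz_prod_diff[of l p "n k", OF l] by (simp add: c_def)
    qed
    then have "norm (riesz l (n k) - 1) \<le> B q"
      using eventually_mono[OF eventually_gt_at_top[of q]]
      by (intro tendsto_upperbound[OF tendsto_norm[OF tendsto_diff[OF lim tendsto_const]]]) auto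
    then show ?thesis using Q[OF Qq] by simp
  qed
  then show "\<exists>no. \<forall>k\<ge>no. norm (riesz l (n k) - 1) < e" by (intro exI allI impI)
qed

text \<open>The real part of the coefficients belongs to the measure symmetrized under conjugation.
  It is even and real, stays positive on real vectors, and inherits the Cesaro bound and the limit
  1, which makes it a possible covariance of a real stationary process.\<close>

lemma exists_correlation:
  fixes n :: "nat \<Rightarrow> int"
  assumes dense: "sphere (0::complex) 1 \<subseteq> closure {z \<in> sphere 0 1. (\<lambda>k. z powi n k) \<longlonglongrightarrow> 1}"
  obtains r :: "int \<Rightarrow> real"
  where "r 0 = 1" and "\<And>m. r (- m) = r m"
    and "\<And>A t. finite A \<Longrightarrow> 0 \<le> (\<Sum>a\<in>A. \<Sum>b\<in>A. t a * t b * r (a - b))"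
    and "\<And>c. (\<lambda>N. (\<Sum>j<N. \<bar>r (int j + c)\<bar>) / real N) \<longlonglongrightarrow> 0"
    and "(\<lambda>k. r (n k)) \<longlonglongrightarrow> 1"
proof (rule exists_rotations[OF dense], goal_cases)
  case (1 l K)
  note l = 1(2) and mean = 1(3) and near = 1(4) and K = 1(5) and below = 1(6) and above = 1(7)
  note lim = riesz_prod_tendsto[of l, OF l near]
  define r where "r m = Re (riesz l m)" for m
  have lim_r: "(\<lambda>p. Re (riesz_prod l p m)) \<longlonglongrightarrow> r m" for m
    unfolding r_def by (intro tendsto_Re lim)
  show thesis
  proof (rule 1(1)[of r])
    show "r 0 = 1"
      using lim_r[of 0] by (simp add: riesz_prod_def riesz_factor_def LIMSEQ_const_iff)
    show "r (- m) = r m" for m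
    proof -
      have "riesz_prod l p (- m) = cnj (riesz_prod l p m)" for p
        unfolding riesz_prod_def riesz_factor_def by (simp add: cnj_powi_unit[OF l] del: complex_cnj_power_int)
      then have "(\<lambda>p. Re (riesz_prod l p m)) \<longlonglongrightarrow> r (- m)" using lim_r[of "- m"] by simp
      then show ?thesis using lim_r[of m] by (rule LIMSEQ_unique)
    qed
    show "0 \<le> (\<Sum>a\<in>A. \<Sum>b\<in>A. t a * t b * r (a - b))" if "finite A" for A t
    proof (rule tendsto_lowerbound)
      show "(\<lambda>p. \<Sum>a\<in>A. \<Sum>b\<in>A. t a * t b * Re (riesz_prod l p (a - b))) \<longlonglongrightarrow> (\<Sum>a\<in>A. \<Sum>b\<in>A. t a * t b * r (a - b))"
        by (intro tendsto_intros lim_r)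
      show "\<forall>\<^sub>F p in sequentially. 0 \<le> (\<Sum>a\<in>A. \<Sum>b\<in>A. t a * t b * Re (riesz_prod l p (a - b)))"
        using riesz_prod_positive[of l A "\<lambda>a. of_real (t a)", OF l that] by simp
    qed simp
    show "(\<lambda>N. (\<Sum>j<N. \<bar>r (int j + c)\<bar>) / real N) \<longlonglongrightarrow> 0" for c
    proof (rule tendsto_sandwich[of "\<lambda>_. 0"])
      show "(\<lambda>N. (\<Sum>j<N. \<bar>norm (riesz l (int j + c))\<bar>) / real N) \<longlonglongrightarrow> 0"
        by (rule mean_abs_of_mean_square[OF mean_riesz[of l, OF l mean lim]])
      show "\<forall>\<^sub>F N in sequentially. (\<Sum>j<N. \<bar>r (int j + c)\<bar>) / real N \<le> (\<Sum>j<N. \<bar>norm (riesz l (int j + c))\<bar>) / real N"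
        by (auto simp: r_def abs_Re_le_cmod intro!: always_eventually divide_right_mono sum_mono)
    qed (auto simp: sum_nonneg)
    show "(\<lambda>k. r (n k)) \<longlonglongrightarrow> 1"
      unfolding r_def using tendsto_Re[OF riesz_tendsto_1[of l K n, OF l lim K below above]] by simp
  qed
qed

section \<open>Gaussian measures on sequence space\<close>

definition psd_kernel :: "('i \<Rightarrow> 'i \<Rightarrow> real) \<Rightarrow> bool" where
  "psd_kernel K \<longleftrightarrow> (\<forall>a b. K a b = K b a) \<and>
    (\<forall>A t. finite A \<longrightarrow> 0 \<le> (\<Sum>a\<in>A. \<Sum>b\<in>A. t a * t b * K a b))"

lemma psd_kernel_sym: "psd_kernel K \<Longrightarrow> K a b = K b a"
  by (simp add: psd_kernel_def)

lemma psd_kernel_nonneg: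
  "psd_kernel K \<Longrightarrow> finite A \<Longrightarrow> 0 \<le> (\<Sum>a\<in>A. \<Sum>b\<in>A. t a * t b * K a b)"
  by (simp add: psd_kernel_def)

lemma psd_kernel_diag: "psd_kernel K \<Longrightarrow> 0 \<le> K i i"
  using psd_kernel_nonneg[of K "{i}" "\<lambda>_. 1"] by simp

text \<open>With entry \<open>s\<close> at \<open>i\<close> and entry 1 at \<open>b\<close> the
  quadratic form is affine in \<open>s\<close>, so a nonzero slope would contradict
  positivity.\<close>

lemma psd_kernel_zero_diag:
  assumes K: "psd_kernel K" and zero: "K i i = 0"
  shows "K i b = 0"
proof (rule ccontr)
  assume nz: "K i b \<noteq> 0"
  then have neq: "i \<noteq> b" using zero by auto
  \<comment> \<open>Solves the affine equation that gives the form the value -1.\<close>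
  define s where "s = - (K b b + 1) / (2 * K i b)"
  have "0 \<le> (\<Sum>x\<in>{i,b}. \<Sum>y\<in>{i,b}. (if x = i then s else 1) * (if y = i then s else 1) * K x y)"
    by (rule psd_kernel_nonneg[OF K]) simp
  also have "\<dots> = 2 * s * K i b + K b b"
    using neq zero psd_kernel_sym[OF K, of b i] by (simp add: algebra_simps)
  also have "\<dots> = -1" using nz by (simp add: s_def field_simps)
  finally show False by simp
qed

text \<open>The covariance of what is left of the variables after subtracting their projections on
  variable \<open>i\<close>.\<close>

definition schur_complement :: "('i \<Rightarrow> 'i \<Rightarrow> real) \<Rightarrow> 'i \<Rightarrow> 'i \<Rightarrow> 'i \<Rightarrow> real" where
  "schur_complement K i a b = K a b - K a i * K b i / K i i"

text \<open>Completing the square: the new form at \<open>t\<close> is the old form at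
  \<open>t\<close> with the entry at \<open>i\<close> shifted by the optimal amount.\<close>

lemma psd_schur_complement:
  assumes K: "psd_kernel K"
  shows "psd_kernel (schur_complement K i)"
proof (cases "K i i = 0")
  case True
  then have "schur_complement K i = K" by (simp add: schur_complement_def fun_eq_iff)
  then show ?thesis using K by simp
next
  case False
  have "0 \<le> (\<Sum>a\<in>A. \<Sum>b\<in>A. t a * t b * schur_complement K i a b)" if A: "finite A" for A t
  proof -
    \<comment> \<open>The index \<open>i\<close> may lie outside \<open>A\<close>, so it is adjoined
      and \<open>t\<close> is padded with zeros.\<close>
    define A' where "A' = insert i A"
    have A': "finite A'" "i \<in> A'" "A \<subseteq> A'" using A by (auto simp: A'_def)
    define u where "u a = (if a \<in> A then t a else 0)" for a
    define c where "c = (\<Sum>a\<in>A'. u a * K a i)"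
    \<comment> \<open>The minimizer of the form when a multiple of the unit vector at
      \<open>i\<close> is subtracted from \<open>u\<close>.\<close>
    define s where "s = c / K i i"
    define d where "d a = (if a = i then s else 0)" for a
    have expand: "(\<Sum>a\<in>A'. \<Sum>b\<in>A'. (u a - d a) * (u b - d b) * K a b) =
       (\<Sum>a\<in>A'. \<Sum>b\<in>A'. u a * u b * K a b) - (\<Sum>a\<in>A'. \<Sum>b\<in>A'. u a * d b * K a b)
       - (\<Sum>a\<in>A'. \<Sum>b\<in>A'. d a * u b * K a b) + (\<Sum>a\<in>A'. \<Sum>b\<in>A'. d a * d b * K a b)"
      by (simp add: sum.distrib[symmetric] sum_subtractf[symmetric] algebra_simps)
    have 1: "(\<Sum>a\<in>A'. \<Sum>b\<in>A'. u a * d b * K a b) = s * c"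
      using A' by (simp add: d_def c_def sum_distrib_left if_distrib[where f="\<lambda>x. x * _"] if_distrib[where f="\<lambda>x. _ * x"] sum.delta mult.commute mult.left_commute cong: if_cong)
    have 2: "(\<Sum>a\<in>A'. \<Sum>b\<in>A'. d a * u b * K a b) = s * c"
    proof -
      have "d a * u b * K a b = u b * d a * K b a" for a b
        using psd_kernel_sym[OF K, of a b] by simp
      then have "(\<Sum>a\<in>A'. \<Sum>b\<in>A'. d a * u b * K a b) = (\<Sum>a\<in>A'. \<Sum>b\<in>A'. u b * d a * K b a)"
        by (intro sum.cong refl)
      also have "\<dots> = (\<Sum>b\<in>A'. \<Sum>a\<in>A'. u b * d a * K b a)" by (rule sum.swap)
      finally show ?thesis unfolding 1 .
    qed
    have 3: "(\<Sum>a\<in>A'. \<Sum>b\<in>A'. d a * d b * K a b) = s * s * K i i"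
      using A' by (simp add: d_def if_distrib[where f="\<lambda>x. x * _"] if_distrib[where f="\<lambda>x. _ * x"] sum.delta cong: if_cong)
    have "0 \<le> (\<Sum>a\<in>A'. \<Sum>b\<in>A'. (u a - d a) * (u b - d b) * K a b)"
      by (rule psd_kernel_nonneg[OF K A'(1)])
    also have "\<dots> = (\<Sum>a\<in>A'. \<Sum>b\<in>A'. u a * u b * K a b) - c * c / K i i"
      unfolding expand 1 2 3 using False by (simp add: s_def field_simps)
    also have "c * c / K i i = (\<Sum>a\<in>A'. \<Sum>b\<in>A'. u a * u b * (K a i * K b i / K i i))"
      by (simp add: c_def sum_product sum_divide_distrib algebra_simps)
    also have "(\<Sum>a\<in>A'. \<Sum>b\<in>A'. u a * u b * K a b) - \<dots> = (\<Sum>a\<in>A'. \<Sum>b\<in>A'. u a * u b * schur_complement K i a b)"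
      by (simp add: schur_complement_def sum_subtractf[symmetric] algebra_simps)
    also have "\<dots> = (\<Sum>a\<in>A. \<Sum>b\<in>A. t a * t b * schur_complement K i a b)"
      using A' by (intro sum.mono_neutral_cong_right) (auto simp: u_def intro!: sum.mono_neutral_cong_right)
    finally show ?thesis .
  qed
  then show ?thesis
    using psd_kernel_sym[OF K] unfolding psd_kernel_def schur_complement_def by (simp add: mult.commute)
qed

text \<open>
  Gaussian elimination. A zero pivot is harmless: the division by zero yields 0, and the row of a
  zero pivot vanishes by positivity.
\<close>

fun residual :: "(nat \<Rightarrow> nat \<Rightarrow> real) \<Rightarrow> nat \<Rightarrow> nat \<Rightarrow> nat \<Rightarrow> real" where
  "residual K 0 = K"
| "residual K (Suc i) = schur_complement (residual K i) i"

lemma psd_residual: "psd_kernel K \<Longrightarrow> psd_kernel (residual K i)"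
  by (induction i) (auto intro: psd_schur_complement)

text \<open>A row cleared at its own step stays zero, because each later correction of row
  \<open>a\<close> carries the factor \<open>residual K i a i\<close>, which is already
  zero.\<close>

lemma residual_eq_0:
  assumes "psd_kernel K" "a < i"
  shows "residual K i a b = 0"
  using assms(2)
proof (induction i arbitrary: a b)
  case (Suc i)
  note psd = psd_residual[OF assms(1), of i]
  show ?case
  proof (cases "a = i")
    case True
    then show ?thesis
      using psd_kernel_zero_diag[OF psd, of i b] psd_kernel_sym[OF psd, of i b]
      by (simp add: schur_complement_def)
  next
    case False
    then show ?thesis using Suc by (simp add: schur_complement_def)
  qed
qed simp

text \<open>The rank-one corrections telescope to \<open>K\<close> minus its residual at stage
  \<open>N\<close>. Only \<open>a < N\<close> is required, because row \<open>a\<close> of that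
  residual vanishes for every \<open>b\<close>.\<close>

lemma cholesky:
  fixes K :: "nat \<Rightarrow> nat \<Rightarrow> real"
  assumes K: "psd_kernel K"
  shows "\<exists>L. \<forall>a b N. a < N \<longrightarrow> K a b = (\<Sum>i<N. L a i * L b i)"
proof (intro exI allI impI)
  define L where "L a i = residual K i a i / sqrt (residual K i i i)" for a i
  fix a b N :: nat assume "a < N"
  have "residual K (Suc i) a b - residual K i a b = - (L a i * L b i)" for i
    using psd_kernel_diag[OF psd_residual[OF K], of i i] by (simp add: schur_complement_def L_def)
  then have "(\<Sum>i<N. - (L a i * L b i)) = residual K N a b - residual K 0 a b"
    using sum_lessThan_telescope[of "\<lambda>i. residual K i a b" N] by simp
  then show "K a b = (\<Sum>i<N. L a i * L b i)"
    using residual_eq_0[OF K \<open>a < N\<close>] by (simp add: sum_negf)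
qed

section \<open>Finite linear functionals and white noise\<close>

inductive_set fin_lin :: "((nat \<Rightarrow> real) \<Rightarrow> real) set" where
  coord: "(\<lambda>x. x i) \<in> fin_lin"
| add: "f \<in> fin_lin \<Longrightarrow> g \<in> fin_lin \<Longrightarrow> (\<lambda>x. f x + g x) \<in> fin_lin"
| scale: "f \<in> fin_lin \<Longrightarrow> (\<lambda>x. c * f x) \<in> fin_lin"

lemma fin_lin_comp:
  assumes "f \<in> fin_lin" "\<And>i. (\<lambda>x. X x i) \<in> fin_lin"
  shows "(\<lambda>x. f (X x)) \<in> fin_lin"
  using assms(1) by induction (auto intro: fin_lin.intros assms(2))

lemma fin_lin_sum: "(\<And>i. f i \<in> fin_lin) \<Longrightarrow> (\<lambda>x. \<Sum>i<N::nat. f i x) \<in> fin_lin"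
proof (induction N)
  case 0
  then show ?case using fin_lin.scale[OF fin_lin.coord, of 0] by simp
qed (auto intro: fin_lin.add)

lemma fin_lin_measurable:
  assumes "f \<in> fin_lin" shows "f \<in> borel_measurable borel"
  using assms by induction auto

lemma fin_lin_representation:
  assumes "f \<in> fin_lin"
  shows "\<exists>d m. \<forall>N\<ge>m. \<forall>x. f x = (\<Sum>i<N::nat. d i * x i)"
  using assms
proof induction
  case (coord i)
  show ?case
    by (intro exI[of _ "\<lambda>j. if j = i then 1 else 0"] exI[of _ "Suc i"])
       (auto simp: if_distrib[where f="\<lambda>x. x * _"] sum.delta cong: if_cong)
next
  case (add f g)
  from add.IH obtain c m where f: "\<And>N x. N \<ge> m \<Longrightarrow> f x = (\<Sum>i<N. c i * x i)" by blast
  from add.IH obtain d k where g: "\<And>N x. N \<ge> k \<Longrightarrow> g x = (\<Sum>i<N. d i * x i)" by blast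
  have "f x + g x = (\<Sum>i<N. (c i + d i) * x i)" if "N \<ge> max m k" for N x
    using f[of N x] g[of N x] that by (simp add: ring_distribs sum.distrib)
  then have "\<forall>N\<ge>max m k. \<forall>x. f x + g x = (\<Sum>i<N. (c i + d i) * x i)" by blast
  then show ?case by (intro exI)
next
  case (scale f c)
  then obtain d m where "\<forall>N\<ge>m. \<forall>x. f x = (\<Sum>i<N. d i * x i)" by blast
  then show ?case
    by (intro exI[of _ "\<lambda>i. c * d i"] exI[of _ m]) (simp add: sum_distrib_left mult.assoc)
qed

definition white_noise :: "(nat \<Rightarrow> real) measure" where
  "white_noise = PiM UNIV (\<lambda>_. std_normal_distribution)"

lemma sets_white_noise [measurable_cong]: "sets white_noise = sets borel"
  unfolding white_noise_def sets_PiM_equal_borel[symmetric] by (intro sets_PiM_cong) auto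

lemma space_white_noise [simp]: "space white_noise = UNIV"
  using sets_eq_imp_space_eq[OF sets_white_noise] by simp

lemma coord_measurable_white_noise [measurable]: "(\<lambda>x. x i) \<in> borel_measurable white_noise"
  using fin_lin_measurable[OF fin_lin.coord] by (simp add: measurable_cong_sets[OF sets_white_noise refl])

lemma prob_space_std_normal: "prob_space std_normal_distribution"
  using real_dist_normal_dist by (rule real_distribution.axioms(1))

interpretation white_noise: prob_space white_noise
  unfolding white_noise_def by (rule prob_space_PiM) (rule prob_space_std_normal)

lemma distr_white_noise: "distr white_noise borel (\<lambda>x. x i) = std_normal_distribution"
proof -
  have "distr white_noise borel (\<lambda>x. x i) = distr white_noise std_normal_distribution (\<lambda>x. x i)"
    by (intro distr_cong) auto
  then show ?thesis
    unfolding white_noise_def using distr_PiM_component[of UNIV "\<lambda>_. std_normal_distribution" i] prob_space_std_normal by simp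
qed

lemma indep_white_noise: "white_noise.indep_vars (\<lambda>_. borel) (\<lambda>i x. x i) UNIV"
proof (subst white_noise.indep_vars_iff_distr_eq_PiM)
  show "distr white_noise (\<Pi>\<^sub>M i\<in>UNIV. borel) (\<lambda>x. \<lambda>i\<in>UNIV. x i) = (\<Pi>\<^sub>M i\<in>UNIV. distr white_noise borel (\<lambda>x. x i))"
    unfolding distr_white_noise white_noise_def[symmetric] restrict_UNIV
    by (rule distr_id2) (simp add: sets_white_noise sets_PiM_equal_borel)
qed auto

lemma white_noise_moments:
  shows "integrable white_noise (\<lambda>x. x i * x j)"
    and "(LINT x|white_noise. x i * x j) = (if i = j then 1 else 0)"
proof -
  have sq: "integrable white_noise (\<lambda>x. (x i)\<^sup>2)" "(LINT x|white_noise. (x i)\<^sup>2) = 1"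
    and lin: "integrable white_noise (\<lambda>x. x i)" "(LINT x|white_noise. x i) = 0" for i
  proof -
    have *: "integrable (distr white_noise borel (\<lambda>x. x i)) (\<lambda>y. y ^ k)" for k
      unfolding distr_white_noise by (rule integrable_std_normal_distribution_moment)
    have **: "(LINT y|distr white_noise borel (\<lambda>x. x i). y ^ k) = (LINT y|std_normal_distribution. y ^ k)" for k
      unfolding distr_white_noise ..
    show "integrable white_noise (\<lambda>x. (x i)\<^sup>2)" "integrable white_noise (\<lambda>x. x i)"
      using *[of 2] *[of 1] by (auto simp: integrable_distr_eq)
    show "(LINT x|white_noise. (x i)\<^sup>2) = 1" "(LINT x|white_noise. x i) = 0"
      using **[of 2] **[of 1] std_normal_distribution_even_moments(1)[of 1] integral_std_normal_distribution_moment_odd[of 1]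
      by (auto simp: integral_distr fact_numeral)
  qed
  have "integrable white_noise (\<lambda>x. x i * x j) \<and> (LINT x|white_noise. x i * x j) = (if i = j then 1 else 0)"
  proof (cases "i = j")
    case True
    then show ?thesis using sq[of i] by (simp add: power2_eq_square)
  next
    case False
    note indep = white_noise.indep_vars_subset[OF indep_white_noise, of "{i, j}"]
    show ?thesis
      using white_noise.indep_vars_lebesgue_integral[OF _ indep] white_noise.indep_vars_integrable[OF _ indep] lin False
      by simp
  qed
  then show "integrable white_noise (\<lambda>x. x i * x j)" "(LINT x|white_noise. x i * x j) = (if i = j then 1 else 0)" by auto
qed

text \<open>Independence factors the characteristic function, and the exponents add up to the
  squared length of \<open>d\<close>, which is the second moment of \<open>f\<close>. Writing the
  variance as an integral frees the formula from coordinates, so that it survives linear changes of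
  variables.\<close>

lemma fin_lin_white_noise:
  assumes "f \<in> fin_lin"
  shows "(CLINT x|white_noise. iexp (f x)) = exp (- (LINT x|white_noise. (f x)\<^sup>2) / 2)"
proof -
  obtain d m where f: "f x = (\<Sum>i<m. d i * x i)" for x
    using fin_lin_representation[OF assms] by blast
  have indep: "white_noise.indep_vars (\<lambda>_. borel) (\<lambda>i x. d i * x i) {..<m}"
    using white_noise.indep_vars_compose2[OF white_noise.indep_vars_subset[OF indep_white_noise, of "{..<m}"], of "\<lambda>i y. d i * y"] by simp
  have char: "char (distr white_noise borel (\<lambda>x. d i * x i)) 1 = exp (- (d i)\<^sup>2 / 2)" for i
  proof -
    have "char (distr white_noise borel (\<lambda>x. d i * x i)) 1 = char (distr white_noise borel (\<lambda>x. x i)) (d i)"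
      unfolding char_def by (subst (1 2) integral_distr) (auto simp: ac_simps)
    then show ?thesis by (simp add: distr_white_noise char_std_normal_distribution)
  qed
  have "(CLINT x|white_noise. iexp (f x)) = char (distr white_noise borel (\<lambda>x. \<Sum>i<m. d i * x i)) 1"
    by (simp add: char_def integral_distr f)
  also have "\<dots> = (\<Prod>i<m. complex_of_real (exp (- (d i)\<^sup>2 / 2)))"
    unfolding white_noise.char_distr_sum[OF indep] char ..
  also have "\<dots> = of_real (\<Prod>i<m. exp (- (d i)\<^sup>2 / 2))"
    by (simp only: of_real_prod)
  also have "(\<Prod>i<m. exp (- (d i)\<^sup>2 / 2)) = exp (- (\<Sum>i<m. (d i)\<^sup>2) / 2)"
    by (simp add: exp_sum[symmetric] sum_negf[symmetric] sum_divide_distrib)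
  also have "(\<Sum>i<m. (d i)\<^sup>2) = (LINT x|white_noise. (f x)\<^sup>2)"
  proof -
    have "(LINT x|white_noise. (f x)\<^sup>2) = (LINT x|white_noise. (\<Sum>i<m. \<Sum>j<m. (d i * d j) * (x i * x j)))"
      unfolding f power2_eq_square sum_product by (intro Bochner_Integration.integral_cong sum.cong) auto
    also have "\<dots> = (\<Sum>i<m. \<Sum>j<m. (d i * d j) * (if i = j then 1 else 0))"
      by (simp add: white_noise_moments integral_sum integrable_sum del: mult_eq_0_iff)
    also have "\<dots> = (\<Sum>i<m. (d i)\<^sup>2)"
      by (simp add: if_distrib[where f="\<lambda>x. _ * x"] sum.delta power2_eq_square cong: if_cong)
    finally show ?thesis ..
  qed
  finally show ?thesis .
qed

text \<open>The measure is the image of white noise under the triangular factor of \<open>K\<close>.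
  Each new coordinate is a finite combination, so no convergence question arises, and linear
  functionals pull back to linear functionals, which carries the characteristic formula
  over.\<close>

lemma exists_gaussian_measure:
  fixes K :: "nat \<Rightarrow> nat \<Rightarrow> real"
  assumes K: "psd_kernel K"
  obtains M :: "(nat \<Rightarrow> real) measure"
  where "prob_space M" "sets M = sets borel"
    and "\<And>a b. integrable M (\<lambda>x. x a * x b)"
    and "\<And>a b. (LINT x|M. x a * x b) = K a b"
    and "\<And>f. f \<in> fin_lin \<Longrightarrow> (CLINT x|M. iexp (f x)) = exp (- (LINT x|M. (f x)\<^sup>2) / 2)"
proof -
  obtain L where L: "\<And>a b N. a < N \<Longrightarrow> K a b = (\<Sum>i<N. L a i * L b i)"
    using cholesky[OF K] by blast
  define X :: "(nat \<Rightarrow> real) \<Rightarrow> nat \<Rightarrow> real" where "X x a = (\<Sum>i<Suc a. L a i * x i)" for x a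
  have X_lin: "(\<lambda>x. X x a) \<in> fin_lin" for a
    unfolding X_def by (intro fin_lin_sum fin_lin.intros)
  have "(\<lambda>x. X x a) \<in> borel_measurable white_noise" for a
    using fin_lin_measurable[OF X_lin] by (simp add: measurable_cong_sets[OF sets_white_noise refl])
  then have "X \<in> measurable white_noise (PiM UNIV (\<lambda>_. borel))"
    by (intro measurable_PiM_single') auto
  then have [measurable]: "X \<in> borel_measurable white_noise"
    by (simp add: measurable_cong_sets[OF refl sets_PiM_equal_borel])
  define M where "M = distr white_noise borel X"
  have prod: "X x a * X x b = (\<Sum>i<Suc a. \<Sum>j<Suc b. L a i * L b j * (x i * x j))" for x a b
    unfolding X_def sum_product by (intro sum.cong) auto
  show thesis
  proof
    show "prob_space M" unfolding M_def by (intro white_noise.prob_space_distr) simp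
    show "sets M = sets borel" by (simp add: M_def)
    fix a b
    show "integrable M (\<lambda>x. x a * x b)"
      unfolding M_def
      by (subst integrable_distr_eq)
        (simp_all add: prod white_noise_moments integrable_sum del: sum.lessThan_Suc)
    have "(LINT x|M. x a * x b) = (LINT x|white_noise. X x a * X x b)"
      unfolding M_def by (subst integral_distr) auto
    also have "\<dots> = (\<Sum>i<Suc a. \<Sum>j<Suc b. L a i * L b j * (if i = j then 1 else 0))"
      unfolding prod by (simp add: white_noise_moments del: sum.lessThan_Suc mult_eq_0_iff)
    also have "\<dots> = (\<Sum>i<Suc a. if i < Suc b then L a i * L b i else 0)"
      by (simp add: if_distrib[where f="\<lambda>x. _ * x"] sum.delta del: sum.lessThan_Suc cong: if_cong)
    also have "\<dots> = (\<Sum>i<min (Suc a) (Suc b). L a i * L b i)"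
      by (intro sum.mono_neutral_cong_right) auto
    also have "\<dots> = K a b"
    \<comment> \<open>The factorization bounds the range by its first index, so the smaller index
      must come first; symmetry of \<open>K\<close> covers the other order.\<close>
    proof (cases "a \<le> b")
      case True
      then show ?thesis using L[of a "Suc a" b] by (simp add: min_def)
    next
      case False
      then show ?thesis using L[of b "Suc b" a] psd_kernel_sym[OF K, of a b] by (simp add: min_def mult.commute)
    qed
    finally show "(LINT x|M. x a * x b) = K a b" .
  next
    fix f assume f: "f \<in> fin_lin"
    note [measurable] = fin_lin_measurable[OF f]
    have "(CLINT x|M. iexp (f x)) = (CLINT x|white_noise. iexp (f (X x)))"
      unfolding M_def by (subst integral_distr) auto
    also have "\<dots> = exp (- (LINT x|white_noise. (f (X x))\<^sup>2) / 2)"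
      by (rule fin_lin_white_noise[OF fin_lin_comp[OF f X_lin]])
    also have "(LINT x|white_noise. (f (X x))\<^sup>2) = (LINT x|M. (f x)\<^sup>2)"
      unfolding M_def by (subst integral_distr) auto
    finally show "(CLINT x|M. iexp (f x)) = exp (- (LINT x|M. (f x)\<^sup>2) / 2)" .
  qed
qed

section \<open>Density of trigonometric functions\<close>

inductive_set trig :: "((nat \<Rightarrow> real) \<Rightarrow> complex) set" where
  char: "f \<in> fin_lin \<Longrightarrow> (\<lambda>x. c * iexp (f x)) \<in> trig"
| add: "F \<in> trig \<Longrightarrow> G \<in> trig \<Longrightarrow> (\<lambda>x. F x + G x) \<in> trig"

lemma trig_const: "(\<lambda>x. c) \<in> trig"
  using trig.char[OF fin_lin.scale[OF fin_lin.coord, of 0], of c] by simp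

lemma trig_scale: "F \<in> trig \<Longrightarrow> (\<lambda>x. c * F x) \<in> trig"
proof (induction rule: trig.induct)
  case (char f d)
  then show ?case using trig.char[of f "c * d"] by (simp add: mult.assoc)
qed (simp add: ring_distribs trig.add)

lemma trig_mult_char: "F \<in> trig \<Longrightarrow> f \<in> fin_lin \<Longrightarrow> (\<lambda>x. F x * iexp (f x)) \<in> trig"
proof (induction rule: trig.induct)
  case (char g c)
  have eq: "c * iexp (g x) * iexp (f x) = c * iexp (g x + f x)" for x
    by (simp add: exp_add ring_distribs)
  show ?case unfolding eq by (rule trig.char[OF fin_lin.add[OF char.hyps char.prems]])
qed (simp add: ring_distribs trig.add)

lemma trig_mult: "G \<in> trig \<Longrightarrow> F \<in> trig \<Longrightarrow> (\<lambda>x. F x * G x) \<in> trig"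
proof (induction rule: trig.induct)
  case (char f c)
  then show ?case using trig_scale[OF trig_mult_char[OF char.prems char.hyps], of c] by (simp add: ac_simps)
qed (simp add: ring_distribs trig.add)

lemma trig_measurable: "F \<in> trig \<Longrightarrow> F \<in> borel_measurable borel"
proof (induction rule: trig.induct)
  case (char f c)
  note [measurable] = fin_lin_measurable[OF char]
  show ?case by measurable
qed simp

lemma trig_bounded: "F \<in> trig \<Longrightarrow> \<exists>B. \<forall>x. norm (F x) \<le> B"
proof (induction rule: trig.induct)
  case (char f c)
  show ?case by (intro exI[of _ "norm c"]) (simp add: norm_mult)
next
  case (add F G)
  then obtain A B where "\<And>x. norm (F x) \<le> A" "\<And>x. norm (G x) \<le> B" by blast
  then have "norm (F x + G x) \<le> A + B" for x
    by (meson add_mono norm_triangle_ineq order.trans)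
  then show ?case by blast
qed

lemma trig_sin: "(\<lambda>x. of_real (sin (c * x i))) \<in> trig"
proof -
  have "complex_of_real (sin y) = (- \<i> / 2) * iexp y + (\<i> / 2) * iexp (- y)" for y
    by (simp add: sin_exp_eq sin_of_real[symmetric] del: sin_of_real) (simp add: field_simps)
  then show ?thesis
    using trig.add[OF trig.char[OF fin_lin.scale[OF fin_lin.coord, of c i], of "- \<i> / 2"]
       trig.char[OF fin_lin.scale[OF fin_lin.coord, of "- c" i], of "\<i> / 2"]] by simp
qed

lemma trig_polynomial:
  assumes "real_polynomial_function p" and h: "(\<lambda>x. of_real (h x)) \<in> trig"
  shows "(\<lambda>x. of_real (p (h x :: real))) \<in> trig"
  using assms(1)
proof induction
  case (linear f)
  then have "f (h x) = f 1 * h x" for x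
    by (metis bounded_linear.linear linear_cmul mult.commute mult.right_neutral real_scaleR_def)
  then show ?case using trig_scale[OF h, of "of_real (f 1)"] by simp
qed (auto intro: trig_const trig.add trig_mult)

text \<open>
  A generating \<open>\<pi>\<close>-system on which statements about trigonometric functions transfer to indicator
  functions by dominated convergence.
\<close>

definition trig_limits :: "(nat \<Rightarrow> real) set set" where
  "trig_limits = {A. \<exists>F B. (\<forall>m::nat. F m \<in> trig) \<and> (\<forall>m x. norm (F m x) \<le> B) \<and>
     (\<forall>x. (\<lambda>m. F m x) \<longlonglongrightarrow> indicator A x)}"

lemma trig_limits_Int:
  assumes "A \<in> trig_limits" "A' \<in> trig_limits"
  shows "A \<inter> A' \<in> trig_limits"
proof -
  obtain F B where F: "\<And>m. F m \<in> trig" "\<And>m x. norm (F m x) \<le> B" "\<And>x. (\<lambda>m. F m x) \<longlonglongrightarrow> indicator A x"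
    using assms(1) unfolding trig_limits_def mem_Collect_eq by blast
  obtain F' B' where F': "\<And>m. F' m \<in> trig" "\<And>m x. norm (F' m x) \<le> B'" "\<And>x. (\<lambda>m. F' m x) \<longlonglongrightarrow> indicator A' x"
    using assms(2) unfolding trig_limits_def mem_Collect_eq by blast
  have "norm (F m x * F' m x) \<le> B * B'" for m x
    unfolding norm_mult by (intro mult_mono F F' norm_ge_zero order.trans[OF norm_ge_zero F(2)])
  moreover have "(\<lambda>m. F m x * F' m x) \<longlonglongrightarrow> indicator (A \<inter> A') x" for x
    unfolding indicator_inter_arith by (intro tendsto_mult F F')
  moreover have "(\<lambda>x. F m x * F' m x) \<in> trig" for m by (intro trig_mult F F')
  ultimately show ?thesis
    unfolding trig_limits_def mem_Collect_eq
    by (intro exI[of _ "\<lambda>m x. F m x * F' m x"] exI[of _ "B * B'"]) simp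
qed

text \<open>Ramps of slope \<open>m\<close> starting at \<open>c\<close> converge pointwise to the
  indicator of the open half-line, even at \<open>c\<close>, where they vanish. Weierstrass replaces
  them by polynomials on a compact interval containing the range of \<open>h\<close>, and a
  polynomial in a real trigonometric function is trigonometric.\<close>

lemma trig_limits_greater:
  assumes h: "(\<lambda>x. of_real (h x)) \<in> trig"
  shows "{x. c < (h x :: real)} \<in> trig_limits"
proof -
  obtain B where B: "\<And>x. \<bar>h x\<bar> \<le> B" using trig_bounded[OF h] by auto
  define g where "g m y = min 1 (max 0 (real m * (y - c)))" for m y
  \<comment> \<open>The tolerance tends to 0, which preserves the limit, and never exceeds 1, which
    gives the uniform bound 2 below.\<close>
  have "\<exists>p. real_polynomial_function p \<and> (\<forall>y\<in>{-B..B}. \<bar>g m y - p y\<bar> < 1 / (real m + 1))" for m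
  proof -
    have "continuous_on {-B..B} (g m)" unfolding g_def by (intro continuous_intros)
    then show ?thesis
      using Stone_Weierstrass_real_polynomial_function[of "{-B..B}" "g m" "1 / (real m + 1)"]
      by (metis compact_Icc of_nat_0_less_iff of_nat_Suc zero_less_Suc add.commute zero_less_divide_1_iff)
  qed
  then obtain p where p: "\<And>m. real_polynomial_function (p m)" "\<And>m y. y \<in> {-B..B} \<Longrightarrow> \<bar>g m y - p m y\<bar> < 1 / (real m + 1)"
    by metis
  have close: "\<bar>g m (h x) - p m (h x)\<bar> < 1 / (real m + 1)" for m x
    using B[of x] by (intro p) auto
  have "norm (complex_of_real (p m (h x))) \<le> 2" for m x
  proof -
    have "1 / (real m + 1) \<le> 1" by (simp add: divide_simps)
    moreover have "0 \<le> g m (h x)" "g m (h x) \<le> 1" by (auto simp: g_def)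
    ultimately have "\<bar>p m (h x)\<bar> \<le> 2" using close[of m x] by linarith
    then show ?thesis by simp
  qed
  moreover have "(\<lambda>m. complex_of_real (p m (h x))) \<longlonglongrightarrow> indicator {x. c < h x} x" for x
  proof -
    have "(\<lambda>m. g m (h x)) \<longlonglongrightarrow> indicator {x. c < h x} x"
    proof (cases "c < h x")
      case True
      have "\<forall>\<^sub>F m in sequentially. 1 / (h x - c) < real m"
        using filterlim_real_sequentially by (auto simp: filterlim_at_top_dense)
      then have "\<forall>\<^sub>F m in sequentially. g m (h x) = 1"
        by eventually_elim (use True in \<open>simp add: g_def field_simps\<close>)
      then show ?thesis using True by (simp add: tendsto_eventually)
    next
      case False
      then have "real m * (h x - c) \<le> 0" for m by (simp add: mult_nonneg_nonpos)
      then have "g m (h x) = 0" for m unfolding g_def by (simp add: max_absorb1)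
      then show ?thesis using False by simp
    qed
    moreover have "(\<lambda>m. p m (h x) - g m (h x)) \<longlonglongrightarrow> 0"
    proof (rule Lim_null_comparison)
      show "\<forall>\<^sub>F m in sequentially. norm (p m (h x) - g m (h x)) \<le> 1 / (real m + 1)"
        using close[of _ x] by (intro always_eventually allI) (simp add: abs_minus_commute less_imp_le)
      show "(\<lambda>m. 1 / (real m + 1)) \<longlonglongrightarrow> 0" by real_asymp
    qed
    ultimately have "(\<lambda>m. (p m (h x) - g m (h x)) + g m (h x)) \<longlonglongrightarrow> 0 + indicator {x. c < h x} x"
      by (intro tendsto_add)
    then have "(\<lambda>m. complex_of_real (p m (h x))) \<longlonglongrightarrow> of_real (indicator {x. c < h x} x)"
      by (intro tendsto_of_real) simp
    then show ?thesis by (simp add: indicator_def of_bool_def split: if_splits)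
  qed
  ultimately show ?thesis
    unfolding trig_limits_def mem_Collect_eq using trig_polynomial[OF p(1) h]
    by (intro exI[of _ "\<lambda>m x. of_real (p m (h x))"] exI[of _ 2]) simp
qed

lemma trig_limits_borel: "A \<in> trig_limits \<Longrightarrow> A \<in> sets borel"
proof -
  assume "A \<in> trig_limits"
  then obtain F where F: "\<And>m. F m \<in> trig" "\<And>x. (\<lambda>m. F m x) \<longlonglongrightarrow> (indicator A x :: complex)"
    unfolding trig_limits_def mem_Collect_eq by blast
  have "(indicator A :: _ \<Rightarrow> complex) \<in> borel_measurable borel"
    by (rule borel_measurable_LIMSEQ_metric[OF trig_measurable[OF F(1)] F(2)])
  then have "(indicator A :: _ \<Rightarrow> complex) -` {1} \<inter> space borel \<in> sets borel"
    by (rule measurable_sets) simp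
  moreover have "(indicator A :: _ \<Rightarrow> complex) -` {1} \<inter> space borel = A"
    by (auto simp: indicator_def)
  ultimately show ?thesis by simp
qed

text \<open>Coordinates are unbounded, hence not trigonometric, but each is the limit of
  \<open>m * sin (x i / m)\<close>. The superlevel sets of these sines lie in the generating system,
  and the coordinates generate the Borel sets of the product.\<close>

lemma sigma_trig_limits: "sigma_sets UNIV trig_limits = sets borel"
proof
  show "sigma_sets UNIV trig_limits \<subseteq> sets borel"
    using sets.sigma_sets_subset[of trig_limits borel] trig_limits_borel by auto
next
  define S where "S = sigma UNIV trig_limits"
  have S: "sets S = sigma_sets UNIV trig_limits" "space S = UNIV" by (auto simp: S_def)
  have "(\<lambda>x. x i) \<in> borel_measurable S" for i
  proof (rule borel_measurable_LIMSEQ_real)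
    show "(\<lambda>m. real m * sin (1 / real m * x i)) \<longlonglongrightarrow> x i" for x :: "nat \<Rightarrow> real"
    proof -
      have "(\<lambda>m. real m * sin (1 / real m * c)) \<longlonglongrightarrow> c" for c :: real
        by real_asymp
      then show ?thesis .
    qed
    show "(\<lambda>x. real m * sin (1 / real m * x i)) \<in> borel_measurable S" for m
    proof -
      have "{x \<in> space S. a < sin (1 / real m * x i)} \<in> sets S" for a
        unfolding S using trig_limits_greater[OF trig_sin, of a "1 / real m" i] by (auto intro: sigma_sets.Basic)
      then have "(\<lambda>x. sin (1 / real m * x i)) \<in> borel_measurable S"
        by (simp add: borel_measurable_iff_greater)
      then show ?thesis by measurable
    qed
  qed
  then have "(\<lambda>x. x) \<in> measurable S (PiM UNIV (\<lambda>_. borel))"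
    by (intro measurable_PiM_single') auto
  then have id: "(\<lambda>x. x) \<in> borel_measurable S"
    by (simp add: measurable_cong_sets[OF refl sets_PiM_equal_borel])
  show "sets borel \<subseteq> sigma_sets UNIV trig_limits"
    using measurable_sets[OF id] S by auto
qed

lemma Int_stable_trig_limits: "Int_stable trig_limits"
  by (auto simp: Int_stable_def intro: trig_limits_Int)

lemma UNIV_trig_limits: "UNIV \<in> trig_limits"
  unfolding trig_limits_def mem_Collect_eq using trig_const[of 1]
  by (intro exI[of _ "\<lambda>m x. 1"] exI[of _ 1]) simp

section \<open>Uniqueness of laws and approximation in mean\<close>

lemma trig_integrable:
  assumes "prob_space M" "sets M = sets borel" "F \<in> trig"
  shows "integrable M F"
proof -
  interpret prob_space M by fact
  obtain B where "\<And>x. norm (F x) \<le> B" using trig_bounded[OF assms(3)] by blast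
  then show ?thesis
    using trig_measurable[OF assms(3)]
    by (intro integrable_const_bound[of _ B]) (auto simp: measurable_cong_sets[OF assms(2) refl])
qed

text \<open>The characteristic functional determines the law: agreement spreads by linearity to
  \<open>trig\<close>, by dominated convergence to the \<pi>-system, and from there to all Borel
  sets.\<close>

lemma prob_eqI_fin_lin:
  fixes M N :: "(nat \<Rightarrow> real) measure"
  assumes M: "prob_space M" "sets M = sets borel" and N: "prob_space N" "sets N = sets borel"
    and eq: "\<And>f. f \<in> fin_lin \<Longrightarrow> (CLINT x|M. iexp (f x)) = (CLINT x|N. iexp (f x))"
  shows "M = N"
proof -
  interpret M: prob_space M by fact
  interpret N: prob_space N by fact
  have trig: "(CLINT x|M. F x) = (CLINT x|N. F x)" if "F \<in> trig" for F
    using that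
  proof induction
    case (char f c)
    then show ?case using eq[of f] by simp
  next
    case (add F G)
    then show ?case using trig_integrable[OF M] trig_integrable[OF N] by simp
  qed
  have "emeasure M A = emeasure N A" if A: "A \<in> trig_limits" for A
  proof -
    obtain F B where F: "\<And>m. F m \<in> trig" "\<And>m x. norm (F m x) \<le> B" "\<And>x. (\<lambda>m. F m x) \<longlonglongrightarrow> indicator A x"
      using A unfolding trig_limits_def mem_Collect_eq by blast
    have "(\<lambda>m. CLINT x|L. F m x) \<longlonglongrightarrow> of_real (measure L A)" if L: "prob_space L" "sets L = sets borel" for L
    proof -
      interpret L: prob_space L by fact
      have A': "A \<in> sets L" using trig_limits_borel[OF A] L by simp
      have "(\<lambda>m. CLINT x|L. F m x) \<longlonglongrightarrow> (CLINT x|L. indicator A x)"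
      proof (rule integral_dominated_convergence[where w="\<lambda>_. B"])
        show "F m \<in> borel_measurable L" for m
          using trig_measurable[OF F(1)] by (simp add: measurable_cong_sets[OF L(2) refl])
      qed (use F A' in auto)
      moreover have "(CLINT x|L. indicator A x) = (CLINT x|L. of_real (indicator A x))"
        by (intro Bochner_Integration.integral_cong) (auto simp: indicator_def)
      ultimately show ?thesis using A' by simp
    qed
    from this[OF M] this[OF N] have "complex_of_real (measure M A) = of_real (measure N A)"
      unfolding trig[OF F(1)] by (rule LIMSEQ_unique)
    then show ?thesis by (simp add: M.emeasure_eq_measure N.emeasure_eq_measure)
  qed
  then show ?thesis
    using UNIV_trig_limits M(2) N(2)
    by (intro measure_eqI_generator_eq[OF Int_stable_trig_limits, of UNIV M N "\<lambda>_. UNIV"])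
       (auto simp: sigma_trig_limits)
qed

text \<open>The approximable sets form a Dynkin system that contains the \<pi>-system
  \<open>trig_limits\<close>, on which dominated convergence gives the approximation.\<close>

lemma trig_L1_dense:
  assumes M: "prob_space M" "sets M = sets borel" and A: "A \<in> sets borel" and "0 < e"
  shows "\<exists>F\<in>trig. (LINT x|M. norm (indicator A x - F x)) < e"
proof -
  interpret prob_space M by fact
  have space: "space M = UNIV" using sets_eq_imp_space_eq[OF M(2)] by simp
  note [measurable_cong] = M(2)
  have int: "integrable M (\<lambda>x. norm (indicator A x - F x))" if "A \<in> sets borel" "F \<in> trig" for A F
  proof -
    have "integrable M (indicator A :: _ \<Rightarrow> complex)"
      using that M(2) by (intro integrable_const_bound[of _ 1]) (auto simp: indicator_def)
    then show ?thesis
      using trig_integrable[OF M that(2)] by (intro integrable_norm Bochner_Integration.integrable_diff)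
  qed
  define D where "D A F = (LINT x|M. norm (indicator A x - F x))" for A and F :: "(nat \<Rightarrow> real) \<Rightarrow> complex"
  define P where "P A \<longleftrightarrow> (\<forall>e>0. \<exists>F\<in>trig. D A F < e)" for A
  have P_Un: "P (A \<union> B)" if A: "A \<in> sets borel" "P A" and B: "B \<in> sets borel" "P B" and disj: "A \<inter> B = {}" for A B
    unfolding P_def
  proof (intro allI impI)
    fix e :: real assume "0 < e"
    then obtain F G where F: "F \<in> trig" "D A F < e/2" and G: "G \<in> trig" "D B G < e/2"
      using A B unfolding P_def by (meson half_gt_zero)
    have "D (A \<union> B) (\<lambda>x. F x + G x) \<le> (LINT x|M. norm (indicator A x - F x) + norm (indicator B x - G x))"
      unfolding D_def
    proof (rule integral_mono)
      fix x
      have eq: "indicator (A \<union> B) x - (F x + G x) = (indicator A x - F x) + (indicator B x - G x)"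
        using disj by (auto simp: indicator_def)
      show "norm (indicator (A \<union> B) x - (F x + G x)) \<le> norm (indicator A x - F x) + norm (indicator B x - G x)"
        unfolding eq by (rule norm_triangle_ineq)
    qed (intro Bochner_Integration.integrable_add int sets.Un trig.add A(1) B(1) F(1) G(1))+
    also have "\<dots> = D A F + D B G"
      unfolding D_def using A B F G by (simp add: int)
    also have "\<dots> < e" using F G by simp
    finally show "\<exists>F\<in>trig. D (A \<union> B) F < e" using trig.add[OF F(1) G(1)] by blast
  qed
  have P_empty: "P {}"
    unfolding P_def D_def using trig_const[of 0] by (auto intro!: bexI[of _ "\<lambda>x. 0"])
  have "Int_stable trig_limits" "trig_limits \<subseteq> Pow UNIV" "A \<in> sigma_sets UNIV trig_limits"
    using A by (auto simp: sigma_trig_limits Int_stable_trig_limits)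
  then have "P A"
  proof (induction rule: sigma_sets_induct_disjoint)
    case (basic A)
    obtain F B where F: "\<And>m. F m \<in> trig" "\<And>m x. norm (F m x) \<le> B" "\<And>x. (\<lambda>m. F m x) \<longlonglongrightarrow> indicator A x"
      using basic unfolding trig_limits_def mem_Collect_eq by blast
    have A': "A \<in> sets M" using trig_limits_borel[OF basic] M by simp
    have "(\<lambda>m. D A (F m)) \<longlonglongrightarrow> (LINT x|M. 0)"
      unfolding D_def
    proof (rule integral_dominated_convergence[where w="\<lambda>_. 1 + B"])
      have [measurable]: "F m \<in> borel_measurable M" for m
        using trig_measurable[OF F(1)] by (simp add: measurable_cong_sets[OF M(2) refl])
      show "(\<lambda>x. norm (indicator A x - F m x)) \<in> borel_measurable M" for m
        using A' by measurable
      show "AE x in M. (\<lambda>m. norm (indicator A x - F m x)) \<longlonglongrightarrow> 0"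
      proof (intro always_eventually allI)
        fix x
        show "(\<lambda>m. norm (indicator A x - F m x)) \<longlonglongrightarrow> 0"
          using tendsto_norm[OF tendsto_diff[OF tendsto_const F(3)], of "indicator A x" x] by simp
      qed
      show "AE x in M. norm (norm (indicator A x - F m x)) \<le> 1 + B" for m
      proof (intro always_eventually allI)
        fix x
        have "norm (indicator A x - F m x) \<le> norm (indicator A x :: complex) + norm (F m x)" by (rule norm_triangle_ineq4)
        also have "\<dots> \<le> 1 + B" using F(2)[of m x] by (intro add_mono) (auto simp: indicator_def)
        finally show "norm (norm (indicator A x - F m x)) \<le> 1 + B" by simp
      qed
    qed auto
    then have "(\<lambda>m. D A (F m)) \<longlonglongrightarrow> 0" by simp
    then have "\<exists>m. D A (F m) < e" if "0 < e" for e
    proof -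
      have "\<forall>\<^sub>F m in sequentially. D A (F m) < e"
        by (rule order_tendstoD(2)[OF _ that]) fact
      then show ?thesis by (rule eventually_happens'[OF sequentially_bot])
    qed
    then show ?case unfolding P_def using F(1) by blast
  next
    case empty
    show ?case by (rule P_empty)
  next
    case (compl A)
    \<comment> \<open>Complements cost nothing: one minus \<open>F\<close> misses the complement by
      exactly as much as \<open>F\<close> misses the set.\<close>
    have "D (UNIV - A) (\<lambda>x. 1 + (- 1) * F x) = D A F" for F
    proof -
      have "norm (indicator (UNIV - A) x - (1 + (- 1) * F x)) = norm (indicator A x - F x)" for x
        by (auto simp: indicator_def norm_minus_commute)
      then show ?thesis unfolding D_def by (simp only:)
    qed
    note eq = this
    show ?case
      unfolding P_def
    proof (intro allI impI)
      fix e :: real assume "0 < e"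
      then obtain F where F: "F \<in> trig" "D A F < e" using compl(2) unfolding P_def by blast
      then show "\<exists>F\<in>trig. D (UNIV - A) F < e"
        by (intro bexI[of _ "\<lambda>x. 1 + (- 1) * F x"] trig.add trig_const trig_scale) (simp_all only: eq)
    qed
  next
    case (union A)
    have A: "A i \<in> sets borel" for i using union by (auto simp: sigma_trig_limits)
    \<comment> \<open>Finite partial unions are approximable by the triangle inequality; continuity
      from below makes the discarded part \<open>U - B n\<close> small.\<close>
    define B where "B n = (\<Union>i<n. A i)" for n
    have B: "B n \<in> sets borel" for n unfolding B_def using A by auto
    have PB: "P (B n)" for n
    proof (induction n)
      case 0
      then show ?case using P_empty by (simp add: B_def)
    next
      case (Suc n)
      have "A i \<inter> A n = {}" if "i < n" for i
        using union(1) that unfolding disjoint_family_on_def by simp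
      then have "B n \<inter> A n = {}" unfolding B_def by blast
      then have "P (B n \<union> A n)" by (intro P_Un B A Suc union(3))
      moreover have "B (Suc n) = B n \<union> A n" by (auto simp: B_def lessThan_Suc)
      ultimately show ?case by simp
    qed
    define U where "U = (\<Union>i. A i)"
    have U: "U = (\<Union>n. B n)" "U \<in> sets borel"
      unfolding U_def B_def using A by (blast, intro sets.countable_UN) blast
    have BU: "B n \<subseteq> U" for n unfolding U(1) by blast
    have "incseq B" unfolding incseq_def B_def by (intro allI impI UN_mono) auto
    then have "(\<lambda>n. measure M (B n)) \<longlonglongrightarrow> measure M (\<Union>n. B n)"
      using B by (intro finite_Lim_measure_incseq) (simp_all add: M(2) image_subset_iff)
    then have lim: "(\<lambda>n. measure M (B n)) \<longlonglongrightarrow> measure M U" unfolding U(1) .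
    show ?case
      unfolding P_def U_def[symmetric]
    proof (intro allI impI)
      fix e :: real assume "0 < e"
      have "\<forall>\<^sub>F n in sequentially. measure M U - e/2 < measure M (B n)"
        by (rule order_tendstoD(1)[OF lim]) (use \<open>0 < e\<close> in simp)
      then obtain n where n: "measure M U - e/2 < measure M (B n)"
        using eventually_happens'[OF sequentially_bot] by blast
      obtain F where F: "F \<in> trig" "D (B n) F < e/2" using PB[of n] half_gt_zero[OF \<open>0 < e\<close>] unfolding P_def by blast
      have ind: "integrable M (indicator (U - B n) :: _ \<Rightarrow> real)"
        using U(2) B by (intro integrable_real_indicator) (simp_all add: M(2) emeasure_eq_measure)
      have "D U F \<le> (LINT x|M. indicator (U - B n) x + norm (indicator (B n) x - F x))"
        unfolding D_def
      proof (rule integral_mono)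
        fix x
        have eq: "indicator U x - F x = complex_of_real (indicator (U - B n) x) + (indicator (B n) x - F x)"
          using BU[of n] by (auto simp: indicator_def)
        have "norm (indicator U x - F x) \<le> norm (complex_of_real (indicator (U - B n) x)) + norm (indicator (B n) x - F x)"
          unfolding eq by (rule norm_triangle_ineq)
        then show "norm (indicator U x - F x) \<le> indicator (U - B n) x + norm (indicator (B n) x - F x)"
          by simp
      qed (intro Bochner_Integration.integrable_add int U(2) B F(1) ind)+
      also have "\<dots> = measure M (U - B n) + D (B n) F"
        unfolding D_def using ind int[OF B F(1)] U(2) B by (simp add: M(2) space)
      also have "measure M (U - B n) = measure M U - measure M (B n)"
        by (intro finite_measure_Diff BU) (simp_all add: M(2) U(2) B)
      finally have "D U F < e" using n F by simp
      then show "\<exists>F\<in>trig. D U F < e" using F by blast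
    qed
  qed
  then show ?thesis using \<open>0 < e\<close> unfolding P_def D_def by blast
qed

section \<open>The Gaussian shift\<close>

text \<open>The coordinates are indexed by the integers through \<^const>\<open>int_decode\<close>.\<close>

definition shift :: "int \<Rightarrow> (nat \<Rightarrow> real) \<Rightarrow> nat \<Rightarrow> real" where
  "shift m x j = x (int_encode (int_decode j + m))"

lemma shift_shift: "shift m (shift k x) = shift (m + k) x"
  by (simp add: shift_def fun_eq_iff ac_simps)

lemma shift_0: "shift 0 x = x"
  by (simp add: shift_def fun_eq_iff)

lemma bij_shift: "bij (shift m)"
  by (rule bij_betw_byWitness[where f'="shift (- m)"]) (auto simp: shift_shift shift_0)

lemma inv_shift: "inv (shift m) = shift (- m)"
  by (rule inv_equality) (simp_all add: shift_shift shift_0)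

lemma funpow_shift: "(shift m ^^ j) x = shift (int j * m) x"
  by (induction j) (simp_all add: shift_0 shift_shift algebra_simps)

lemma iter_int_shift: "iter_int (shift 1) m x = shift m x"
  by (simp add: iter_int_def inv_shift funpow_shift)

lemma fin_lin_shift: "f \<in> fin_lin \<Longrightarrow> (\<lambda>x. f (shift m x)) \<in> fin_lin"
  by (rule fin_lin_comp) (auto simp: shift_def intro: fin_lin.coord)

lemma shift_measurable [measurable]: "shift m \<in> borel_measurable borel"
proof -
  have "(\<lambda>x. shift m x i) \<in> borel_measurable borel" for i
    unfolding shift_def by (rule fin_lin_measurable[OF fin_lin.coord])
  then have "shift m \<in> measurable borel (PiM UNIV (\<lambda>_. borel))"
    by (intro measurable_PiM_single') auto
  then show ?thesis by (simp add: measurable_cong_sets[OF refl sets_PiM_equal_borel])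
qed

lemma trig_shift: "F \<in> trig \<Longrightarrow> (\<lambda>x. F (shift m x)) \<in> trig"
proof (induction rule: trig.induct)
  case (char f c)
  show ?case by (rule trig.char[OF fin_lin_shift[OF char]])
qed (rule trig.add)

section \<open>Sequences whose absolute values have vanishing Cesaro mean\<close>

definition null_mean :: "(nat \<Rightarrow> real) \<Rightarrow> bool" where
  "null_mean a \<longleftrightarrow> (\<lambda>N. (\<Sum>j<N. \<bar>a j\<bar>) / real N) \<longlonglongrightarrow> 0"

lemma null_mean_add: "null_mean a \<Longrightarrow> null_mean b \<Longrightarrow> null_mean (\<lambda>j. \<bar>a j\<bar> + \<bar>b j\<bar>)"
  unfolding null_mean_def using tendsto_add[of _ 0 _ _ 0] by (simp add: sum.distrib add_divide_distrib)

lemma null_mean_scale: "null_mean a \<Longrightarrow> null_mean (\<lambda>j. c * a j)"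
  unfolding null_mean_def abs_mult sum_distrib_left[symmetric] times_divide_eq_right[symmetric]
  by (rule tendsto_mult_right_zero)

text \<open>A uniform error survives averaging unchanged. This closure property later carries mixing
  from trigonometric functions to sets.\<close>

lemma null_mean_approx:
  assumes "\<And>e. 0 < e \<Longrightarrow> \<exists>b. null_mean b \<and> (\<forall>j. \<bar>a j\<bar> \<le> \<bar>b j\<bar> + e)"
  shows "null_mean a"
  unfolding null_mean_def
proof (rule LIMSEQ_I)
  fix e :: real assume "0 < e"
  then obtain b where b: "null_mean b" "\<And>j. \<bar>a j\<bar> \<le> \<bar>b j\<bar> + e / 2"
    using assms[of "e/2"] by auto
  obtain M where M: "\<And>N. N \<ge> M \<Longrightarrow> (\<Sum>j<N. \<bar>b j\<bar>) / real N < e / 2"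
    using order_tendstoD(2)[OF b(1)[unfolded null_mean_def], of "e/2"] \<open>0 < e\<close>
    by (auto simp: eventually_sequentially)
  have "norm ((\<Sum>j<N. \<bar>a j\<bar>) / real N - 0) < e" if "N \<ge> M" for N
  proof -
    have "(\<Sum>j<N. \<bar>a j\<bar>) / real N \<le> (\<Sum>j<N. \<bar>b j\<bar> + e / 2) / real N"
      by (intro divide_right_mono sum_mono b) simp
    also have "\<dots> \<le> (\<Sum>j<N. \<bar>b j\<bar>) / real N + e / 2"
      using \<open>0 < e\<close> by (simp add: sum.distrib add_divide_distrib)
    also have "\<dots> < e" using M[OF that] by linarith
    finally show ?thesis by (simp add: sum_nonneg)
  qed
  then show "\<exists>no. \<forall>N\<ge>no. norm ((\<Sum>j<N. \<bar>a j\<bar>) / real N - 0) < e" by blast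
qed

lemma null_mean_mono: "null_mean b \<Longrightarrow> (\<And>j. \<bar>a j\<bar> \<le> \<bar>b j\<bar>) \<Longrightarrow> null_mean a"
  by (rule null_mean_approx) (meson add_increasing2 less_imp_le)

text \<open>The derivative of \<open>exp\<close> is at most 1 on the negative half-line, where the
  exponents of Gaussian characteristic functions lie.\<close>

lemma exp_lipschitz_nonpos:
  fixes u v :: real
  assumes "u \<le> 0" "v \<le> 0"
  shows "\<bar>exp u - exp v\<bar> \<le> \<bar>u - v\<bar>"
proof -
  have "exp v - exp u \<le> v - u" if "u \<le> v" "v \<le> 0" for u v :: real
  proof -
    have "exp v - exp u = exp v * (1 - exp (u - v))" by (simp add: exp_diff field_simps)
    also have "\<dots> \<le> 1 * (v - u)"
    proof (intro mult_mono)
      show "1 - exp (u - v) \<le> v - u" using exp_ge_add_one_self[of "u - v"] by linarith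
    qed (use that in auto)
    finally show ?thesis by simp
  qed
  from this[of u v] this[of v u] show ?thesis using assms by (cases "u \<le> v") auto
qed

section \<open>Stationarity, mixing and rigidity on trigonometric functions\<close>

locale gaussian_shift = prob_space M
  for M :: "(nat \<Rightarrow> real) measure" and r :: "int \<Rightarrow> real" +
  assumes sets_M: "sets M = sets borel"
    and integrable_coord: "\<And>a b. integrable M (\<lambda>x. x a * x b)"
    and cov_coord: "\<And>a b. (LINT x|M. x a * x b) = r (int_decode a - int_decode b)"
    and char_fin_lin: "\<And>f. f \<in> fin_lin \<Longrightarrow> (CLINT x|M. iexp (f x)) = exp (- (LINT x|M. (f x)\<^sup>2) / 2)"
    and r_0: "r 0 = 1"
begin

lemma space_M: "space M = UNIV"
  using sets_eq_imp_space_eq[OF sets_M] by simp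

lemma borel_measurable_M: "f \<in> borel_measurable borel \<Longrightarrow> f \<in> borel_measurable M"
  by (simp add: measurable_cong_sets[OF sets_M refl])

lemma shift_measurable_M [measurable]: "shift m \<in> measurable M M"
  using shift_measurable by (simp add: measurable_cong_sets[OF sets_M sets_M])

lemma integrable_fin_lin:
  assumes "f \<in> fin_lin" "g \<in> fin_lin"
  shows "integrable M (\<lambda>x. f x * g x)"
  using assms(1)
proof induction
  case (coord i)
  show ?case using assms(2)
  proof induction
    case (coord j)
    show ?case by (rule integrable_coord)
  next
    case (scale f c)
    then show ?case using integrable_mult_right[of c M] by (simp add: mult.left_commute)
  qed (simp add: ring_distribs)
next
  case (scale f c)
  then show ?case using integrable_mult_right[of c M] by (simp add: mult.assoc)
qed (simp add: ring_distribs)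

text \<open>Covariances of coordinates depend only on the difference of the decoded indices, and
  both sides are bilinear.\<close>

lemma cov_shift:
  assumes f: "f \<in> fin_lin" and g: "g \<in> fin_lin"
  shows "(LINT x|M. f (shift m x) * g (shift m x)) = (LINT x|M. f x * g x)"
  using f
proof induction
  case (coord i)
  show ?case using g
  proof induction
    case (coord j)
    show ?case by (simp add: shift_def cov_coord)
  next
    case (add f g)
    then show ?case
      using integrable_fin_lin[OF fin_lin.coord] fin_lin_shift[of _ m] fin_lin_shift[OF fin_lin.coord, of m]
      by (simp add: ring_distribs integrable_fin_lin)
  next
    case (scale f c)
    then show ?case by (simp add: mult.left_commute)
  qed
next
  case (add f f')
  then show ?case
    using fin_lin_shift[of _ m] g by (simp add: ring_distribs integrable_fin_lin)
next
  case (scale f c)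
  then show ?case by (simp add: mult.assoc)
qed

text \<open>A centred Gaussian law is determined by its covariance, and the shift preserves the
  covariance.\<close>

lemma distr_shift: "distr M M (shift m) = M"
proof (rule prob_eqI_fin_lin)
  show "prob_space (distr M M (shift m))" by (rule prob_space_distr) measurable
  show "prob_space M" by unfold_locales
  fix f assume f: "f \<in> fin_lin"
  note [measurable] = borel_measurable_M[OF fin_lin_measurable[OF f]]
  have "(CLINT x|distr M M (shift m). iexp (f x)) = (CLINT x|M. iexp (f (shift m x)))"
    by (subst integral_distr) auto
  also have "\<dots> = (CLINT x|M. iexp (f x))"
    unfolding char_fin_lin[OF f] char_fin_lin[OF fin_lin_shift[OF f]] power2_eq_square cov_shift[OF f f] ..
  finally show "(CLINT x|distr M M (shift m). iexp (f x)) = (CLINT x|M. iexp (f x))" .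
qed (simp_all add: sets_M)

lemma integral_shift:
  fixes f :: "(nat \<Rightarrow> real) \<Rightarrow> 'b::{banach, second_countable_topology}"
  assumes [measurable]: "f \<in> borel_measurable M"
  shows "(LINT x|M. f (shift m x)) = (LINT x|M. f x)"
proof -
  have "(LINT x|M. f (shift m x)) = (LINT x|distr M M (shift m). f x)"
    by (subst integral_distr) auto
  then show ?thesis by (simp add: distr_shift)
qed

lemma integrable_shift:
  fixes f :: "(nat \<Rightarrow> real) \<Rightarrow> 'b::{banach, second_countable_topology}"
  assumes "integrable M f"
  shows "integrable M (\<lambda>x. f (shift m x))"
proof (rule integrable_distr[where M'=M and T="shift m"])
  show "shift m \<in> measurable M M" by measurable
  show "integrable (distr M M (shift m)) f" using assms by (simp add: distr_shift)
qed

lemma integrable_trig: "F \<in> trig \<Longrightarrow> integrable M F"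
  using prob_space_axioms sets_M by (rule trig_integrable)

text \<open>Bilinearity reduces the claim to two coordinates, whose covariance at time
  \<open>j\<close> is \<open>r (j + c)\<close> with \<open>c\<close> the difference of their decoded
  indices.\<close>

lemma null_mean_cov:
  assumes mix: "\<And>c. null_mean (\<lambda>j. r (int j + c))" and f: "f \<in> fin_lin" and g: "g \<in> fin_lin"
  shows "null_mean (\<lambda>j. LINT x|M. f (shift (int j) x) * g x)"
  using f
proof induction
  case (coord a)
  show ?case using g
  proof induction
    case (coord b)
    show ?case using mix[of "int_decode a - int_decode b"] by (simp add: shift_def cov_coord add.commute add_diff_eq)
  next
    case (add g g')
    have "(LINT x|M. shift (int j) x a * (g x + g' x)) = (LINT x|M. shift (int j) x a * g x) + (LINT x|M. shift (int j) x a * g' x)" for j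
      using integrable_fin_lin[OF fin_lin_shift[OF fin_lin.coord, of "int j" a]] add.hyps by (simp add: ring_distribs)
    then show ?case
      by (intro null_mean_mono[OF null_mean_add[OF add.IH]]) simp
  next
    case (scale g c)
    then show ?case using null_mean_scale[OF scale.IH, of c] by (simp add: mult.left_commute)
  qed
next
  case (add f f')
  have "(LINT x|M. (f (shift (int j) x) + f' (shift (int j) x)) * g x) =
      (LINT x|M. f (shift (int j) x) * g x) + (LINT x|M. f' (shift (int j) x) * g x)" for j
    using integrable_fin_lin[OF fin_lin_shift[of _ "int j"] g] add.hyps by (simp add: ring_distribs)
  then show ?case
    by (intro null_mean_mono[OF null_mean_add[OF add.IH]]) simp
next
  case (scale f c)
  then show ?case using null_mean_scale[OF scale.IH, of c] by (simp add: mult.assoc)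
qed

text \<open>
  Both terms on the left are real exponentials of nonpositive numbers that differ by the covariance.
\<close>

lemma norm_char_correlation_le:
  assumes f: "f \<in> fin_lin" and g: "g \<in> fin_lin"
  shows "norm ((CLINT x|M. iexp (f (shift m x)) * iexp (g x)) - (CLINT x|M. iexp (f x)) * (CLINT x|M. iexp (g x)))
    \<le> \<bar>LINT x|M. f (shift m x) * g x\<bar>"
proof -
  define Q where "Q f = (LINT x|M. (f x)\<^sup>2)" for f :: "(nat \<Rightarrow> real) \<Rightarrow> real"
  define c where "c = (LINT x|M. f (shift m x) * g x)"
  define h where "h x = f (shift m x) + g x" for x
  have fs: "(\<lambda>x. f (shift m x)) \<in> fin_lin" by (rule fin_lin_shift[OF f])
  have h: "h \<in> fin_lin" unfolding h_def by (rule fin_lin.add[OF fs g])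
  have "Q h = (LINT x|M. f (shift m x) * f (shift m x) + 2 * (f (shift m x) * g x) + g x * g x)"
    unfolding Q_def h_def by (simp add: power2_eq_square algebra_simps)
  also have "\<dots> = Q f + 2 * c + Q g"
    using integrable_fin_lin[OF fs fs] integrable_fin_lin[OF fs g] integrable_fin_lin[OF g g] cov_shift[OF f f, of m]
    by (simp add: Q_def c_def power2_eq_square)
  finally have Qh: "Q h = Q f + 2 * c + Q g" .
  have "iexp (f (shift m x)) * iexp (g x) = iexp (h x)" for x
    by (simp add: h_def exp_add ring_distribs)
  then have "(CLINT x|M. iexp (f (shift m x)) * iexp (g x)) = exp (- Q h / 2)"
    using char_fin_lin[OF h] by (simp add: Q_def)
  moreover have "(CLINT x|M. iexp (f x)) * (CLINT x|M. iexp (g x)) = exp (- (Q f + Q g) / 2)"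
  proof -
    have "- (Q f + Q g) / 2 = (- Q f / 2) + (- Q g / 2)" by (simp add: field_simps)
    then show ?thesis unfolding char_fin_lin[OF f] char_fin_lin[OF g] Q_def[symmetric] by (simp only: exp_add of_real_mult)
  qed
  ultimately have "norm ((CLINT x|M. iexp (f (shift m x)) * iexp (g x)) - (CLINT x|M. iexp (f x)) * (CLINT x|M. iexp (g x)))
    = \<bar>exp (- Q h / 2) - exp (- (Q f + Q g) / 2)\<bar>"
    by (simp only: of_real_diff[symmetric] norm_of_real)
  also have "\<dots> \<le> \<bar>- Q h / 2 - (- (Q f + Q g) / 2)\<bar>"
  proof (rule exp_lipschitz_nonpos)
    have "0 \<le> Q u" for u by (simp add: Q_def)
    from this[of f] this[of g] this[of h] show "- Q h / 2 \<le> 0" "- (Q f + Q g) / 2 \<le> 0" by auto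
  qed
  also have "\<dots> = \<bar>c\<bar>" unfolding Qh by (simp add: field_simps)
  finally show ?thesis unfolding c_def .
qed

definition correlation :: "((nat \<Rightarrow> real) \<Rightarrow> complex) \<Rightarrow> ((nat \<Rightarrow> real) \<Rightarrow> complex) \<Rightarrow> int \<Rightarrow> complex" where
  "correlation F G m = (CLINT x|M. F (shift m x) * G x) - (CLINT x|M. F x) * (CLINT x|M. G x)"

lemma integrable_trig_product: "F \<in> trig \<Longrightarrow> G \<in> trig \<Longrightarrow> integrable M (\<lambda>x. F (shift m x) * G x)"
  by (intro integrable_trig trig_mult[of G] trig_shift)

lemma null_mean_trig:
  assumes mix: "\<And>c. null_mean (\<lambda>j. r (int j + c))" and F: "F \<in> trig" and G: "G \<in> trig"
  shows "null_mean (\<lambda>j. norm (correlation F G (int j)))"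
  using F
proof induction
  case (char f c)
  show ?case using G
  proof induction
    case (char g d)
    have eq: "correlation (\<lambda>x. c * iexp (f x)) (\<lambda>x. d * iexp (g x)) m = (c * d) * correlation (\<lambda>x. iexp (f x)) (\<lambda>x. iexp (g x)) m" for m
    proof -
      have "(c * iexp (f (shift m x))) * (d * iexp (g x)) = (c * d) * (iexp (f (shift m x)) * iexp (g x))" for x
        by (simp only: ac_simps)
      then show ?thesis unfolding correlation_def by (simp add: algebra_simps)
    qed
    have "null_mean (\<lambda>j. norm (c * d) * (LINT x|M. f (shift (int j) x) * g x))"
      by (intro null_mean_scale null_mean_cov mix \<open>f \<in> fin_lin\<close> \<open>g \<in> fin_lin\<close>)
    then show ?case
      by (rule null_mean_mono)
         (simp add: eq norm_mult abs_mult mult_left_mono correlation_def norm_char_correlation_le[OF \<open>f \<in> fin_lin\<close> \<open>g \<in> fin_lin\<close>] del: abs_mult_self_eq)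
  next
    case (add G G')
    have F: "(\<lambda>x. c * iexp (f x)) \<in> trig" by (rule trig.char[OF \<open>f \<in> fin_lin\<close>])
    have "correlation (\<lambda>x. c * iexp (f x)) (\<lambda>x. G x + G' x) m = correlation (\<lambda>x. c * iexp (f x)) G m + correlation (\<lambda>x. c * iexp (f x)) G' m" for m
      unfolding correlation_def
      using integrable_trig_product[OF F add.hyps(1), of m] integrable_trig_product[OF F add.hyps(2), of m] integrable_trig[OF add.hyps(1)] integrable_trig[OF add.hyps(2)]
      by (simp add: ring_distribs)
    then show ?case
      by (intro null_mean_mono[OF null_mean_add[OF add.IH]]) (simp add: norm_triangle_ineq)
  qed
next
  case (add F F')
  have "correlation (\<lambda>x. F x + F' x) G m = correlation F G m + correlation F' G m" for m
    unfolding correlation_def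
    using integrable_trig_product[OF add.hyps(1) G, of m] integrable_trig_product[OF add.hyps(2) G, of m] integrable_trig[OF add.hyps(1)] integrable_trig[OF add.hyps(2)]
    by (simp add: ring_distribs)
  then show ?case
    by (intro null_mean_mono[OF null_mean_add[OF add.IH]]) (simp add: norm_triangle_ineq)
qed

text \<open>The increment of a coordinate has second moment \<open>2 - 2 * r (n k)\<close>. The
  first moment is what is propagated: it is subadditive, and it suffices for the Lipschitz map
  \<open>iexp\<close>.\<close>

lemma rigid_fin_lin:
  assumes rig: "(\<lambda>k. r (n k)) \<longlonglongrightarrow> 1" and f: "f \<in> fin_lin"
  shows "(\<lambda>k. LINT x|M. \<bar>f (shift (n k) x) - f x\<bar>) \<longlonglongrightarrow> 0"
  using f
proof induction
  case (coord a)
  define d where "d k x = shift (n k) x a - x a" for k and x :: "nat \<Rightarrow> real"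
  have d: "d k \<in> fin_lin" for k
    using fin_lin.add[OF fin_lin_shift[OF fin_lin.coord, of "n k" a] fin_lin.scale[OF fin_lin.coord, of "- 1" a]]
    by (simp add: d_def[abs_def])
  have sq: "integrable M (\<lambda>x. (d k x)\<^sup>2)" for k
    using integrable_fin_lin[OF d d, of k k] by (simp add: power2_eq_square)
  have var: "(LINT x|M. (d k x)\<^sup>2) = 2 - 2 * r (n k)" for k
  proof -
    have "(LINT x|M. (d k x)\<^sup>2) = (LINT x|M. shift (n k) x a * shift (n k) x a - 2 * (shift (n k) x a * x a) + x a * x a)"
      by (simp add: d_def power2_eq_square algebra_simps)
    also have "\<dots> = 2 - 2 * r (n k)"
      by (simp add: shift_def integrable_coord cov_coord r_0)
    finally show ?thesis .
  qed
  have int: "integrable M (\<lambda>x. \<bar>d k x\<bar>)" for k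
  proof (rule square_integrable_imp_integrable)
    show "(\<lambda>x. \<bar>d k x\<bar>) \<in> borel_measurable M"
      using borel_measurable_M[OF fin_lin_measurable[OF d]] by measurable
  qed (use sq in simp)
  have "(LINT x|M. \<bar>d k x\<bar>) \<le> sqrt (2 - 2 * r (n k))" for k
  proof (rule real_le_rsqrt)
    \<comment> \<open>Nonnegativity of the variance bounds the squared first moment by the second
      moment.\<close>
    have "0 \<le> variance (\<lambda>x. \<bar>d k x\<bar>)" by (rule variance_positive)
    also have "\<dots> = (LINT x|M. (d k x)\<^sup>2) - (LINT x|M. \<bar>d k x\<bar>)\<^sup>2"
      using variance_eq[OF int] sq by simp
    finally show "(LINT x|M. \<bar>d k x\<bar>)\<^sup>2 \<le> 2 - 2 * r (n k)" using var by simp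
  qed
  moreover have "(\<lambda>k. sqrt (2 - 2 * r (n k))) \<longlonglongrightarrow> sqrt (2 - 2 * 1)"
    by (intro tendsto_intros rig)
  ultimately show ?case
    unfolding d_def
    by (intro tendsto_sandwich[OF _ _ tendsto_const[of 0], of "\<lambda>k. LINT x|M. \<bar>shift (n k) x a - x a\<bar>" _ "\<lambda>k. sqrt (2 - 2 * r (n k))"]) auto
next
  case (add f g)
  have int: "integrable M (\<lambda>x. \<bar>f (shift m x) - f x\<bar>)" if "f \<in> fin_lin" for f m
  proof -
    have "integrable M f"
    proof (rule square_integrable_imp_integrable)
      show "f \<in> borel_measurable M"
        using borel_measurable_M[OF fin_lin_measurable[OF that]] .
      show "integrable M (\<lambda>x. (f x)\<^sup>2)"
        using integrable_fin_lin[OF that that] by (simp add: power2_eq_square)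
    qed
    then show ?thesis
      by (intro integrable_abs Bochner_Integration.integrable_diff integrable_shift)
  qed
  show ?case
  proof (rule tendsto_sandwich[OF _ _ tendsto_const[of 0]])
    show "\<forall>\<^sub>F k in sequentially. (LINT x|M. \<bar>f (shift (n k) x) + g (shift (n k) x) - (f x + g x)\<bar>)
        \<le> (LINT x|M. \<bar>f (shift (n k) x) - f x\<bar>) + (LINT x|M. \<bar>g (shift (n k) x) - g x\<bar>)"
    proof (intro always_eventually allI)
      fix k
      have "(LINT x|M. \<bar>f (shift (n k) x) + g (shift (n k) x) - (f x + g x)\<bar>)
          \<le> (LINT x|M. \<bar>f (shift (n k) x) - f x\<bar> + \<bar>g (shift (n k) x) - g x\<bar>)"
        by (intro integral_mono int[OF fin_lin.add[OF add.hyps]] Bochner_Integration.integrable_add int add.hyps) auto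
      also have "\<dots> = (LINT x|M. \<bar>f (shift (n k) x) - f x\<bar>) + (LINT x|M. \<bar>g (shift (n k) x) - g x\<bar>)"
        by (intro Bochner_Integration.integral_add int add.hyps)
      finally show "(LINT x|M. \<bar>f (shift (n k) x) + g (shift (n k) x) - (f x + g x)\<bar>) \<le> \<dots>" .
    qed
    show "(\<lambda>k. (LINT x|M. \<bar>f (shift (n k) x) - f x\<bar>) + (LINT x|M. \<bar>g (shift (n k) x) - g x\<bar>)) \<longlonglongrightarrow> 0"
      using tendsto_add[OF add.IH] by simp
  qed simp
next
  case (scale f c)
  have "\<bar>c * f (shift m x) - c * f x\<bar> = \<bar>c\<bar> * \<bar>f (shift m x) - f x\<bar>" for m x
    by (simp only: abs_mult[symmetric] right_diff_distrib)
  then show ?case using tendsto_mult_left[OF scale.IH, of "\<bar>c\<bar>"] by simp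
qed

text \<open>The map \<open>iexp\<close> is Lipschitz with constant 1, so the increments of a
  character are dominated by those of its exponent.\<close>

lemma rigid_trig:
  assumes rig: "(\<lambda>k. r (n k)) \<longlonglongrightarrow> 1" and F: "F \<in> trig"
  shows "(\<lambda>k. LINT x|M. norm (F (shift (n k) x) - F x)) \<longlonglongrightarrow> 0"
  using F
proof induction
  case (char f c)
  have le: "norm (iexp s - iexp t) \<le> \<bar>s - t\<bar>" for s t :: real
  proof -
    have "iexp s - iexp t = iexp t * (iexp (s - t) - 1)"
      by (simp add: ring_distribs exp_diff)
    then have "norm (iexp s - iexp t) = norm (iexp (s - t) - 1)" by (simp add: norm_mult)
    also have "\<dots> \<le> \<bar>s - t\<bar>" using iexp_approx1[of "s - t" 0] by simp
    finally show ?thesis .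
  qed
  have abs_int: "integrable M (\<lambda>x. \<bar>f (shift m x) - f x\<bar>)" for m
  proof (rule square_integrable_imp_integrable)
    have d: "(\<lambda>x. f (shift m x) + (- 1) * f x) \<in> fin_lin"
      by (rule fin_lin.add[OF fin_lin_shift[OF char] fin_lin.scale[OF char]])
    show "(\<lambda>x. \<bar>f (shift m x) - f x\<bar>) \<in> borel_measurable M"
      using borel_measurable_M[OF fin_lin_measurable[OF d]] by simp
    show "integrable M (\<lambda>x. \<bar>f (shift m x) - f x\<bar>\<^sup>2)"
      using integrable_fin_lin[OF d d] by (simp add: power2_eq_square)
  qed
  have F: "(\<lambda>x. c * iexp (f x)) \<in> trig" by (rule trig.char[OF char])
  show ?case
  proof (rule tendsto_sandwich[OF _ _ tendsto_const[of 0]])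
    show "\<forall>\<^sub>F k in sequentially. (LINT x|M. norm (c * iexp (f (shift (n k) x)) - c * iexp (f x)))
        \<le> (LINT x|M. norm c * \<bar>f (shift (n k) x) - f x\<bar>)"
    proof (intro always_eventually allI integral_mono)
      fix k x
      show "norm (c * iexp (f (shift (n k) x)) - c * iexp (f x)) \<le> norm c * \<bar>f (shift (n k) x) - f x\<bar>"
        unfolding right_diff_distrib[symmetric] norm_mult by (intro mult_left_mono le) simp
    next
      fix k
      show "integrable M (\<lambda>x. norm (c * iexp (f (shift (n k) x)) - c * iexp (f x)))"
        by (intro integrable_norm Bochner_Integration.integrable_diff integrable_trig F trig_shift[OF F])
    qed (intro integrable_mult_right abs_int)
    show "(\<lambda>k. LINT x|M. norm c * \<bar>f (shift (n k) x) - f x\<bar>) \<longlonglongrightarrow> 0"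
      using tendsto_mult_left[OF rigid_fin_lin[OF rig char], of "norm c"] by simp
  qed simp
next
  case (add F G)
  have int: "integrable M (\<lambda>x. norm (F (shift m x) - F x))" if "F \<in> trig" for F m
    by (intro integrable_norm Bochner_Integration.integrable_diff integrable_trig that trig_shift[OF that])
  show ?case
  proof (rule tendsto_sandwich[OF _ _ tendsto_const[of 0]])
    show "\<forall>\<^sub>F k in sequentially. (LINT x|M. norm (F (shift (n k) x) + G (shift (n k) x) - (F x + G x)))
        \<le> (LINT x|M. norm (F (shift (n k) x) - F x)) + (LINT x|M. norm (G (shift (n k) x) - G x))"
    proof (intro always_eventually allI)
      fix k
      have "(LINT x|M. norm (F (shift (n k) x) + G (shift (n k) x) - (F x + G x)))
          \<le> (LINT x|M. norm (F (shift (n k) x) - F x) + norm (G (shift (n k) x) - G x))"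
        by (intro integral_mono int[OF trig.add[OF add.hyps]] Bochner_Integration.integrable_add int add.hyps)
           (simp add: add_diff_add norm_triangle_ineq)
      also have "\<dots> = (LINT x|M. norm (F (shift (n k) x) - F x)) + (LINT x|M. norm (G (shift (n k) x) - G x))"
        by (intro Bochner_Integration.integral_add int add.hyps)
      finally show "(LINT x|M. norm (F (shift (n k) x) + G (shift (n k) x) - (F x + G x))) \<le> \<dots>" .
    qed
    show "(\<lambda>k. (LINT x|M. norm (F (shift (n k) x) - F x)) + (LINT x|M. norm (G (shift (n k) x) - G x))) \<longlonglongrightarrow> 0"
      using tendsto_add[OF add.IH] by simp
  qed simp
qed

end

section \<open>From trigonometric functions to sets and square-integrable functions\<close>

context gaussian_shift begin

text \<open>A common class for indicators and trigonometric functions, closed under differences,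
  products and shifts.\<close>

definition bounded_rv :: "((nat \<Rightarrow> real) \<Rightarrow> complex) \<Rightarrow> bool" where
  "bounded_rv F \<longleftrightarrow> F \<in> borel_measurable M \<and> (\<exists>C. \<forall>x. norm (F x) \<le> C)"

lemma bounded_rv_integrable: "bounded_rv F \<Longrightarrow> integrable M F"
  unfolding bounded_rv_def by (auto intro: integrable_const_bound)

lemma bounded_rv_diff: "bounded_rv F \<Longrightarrow> bounded_rv G \<Longrightarrow> bounded_rv (\<lambda>x. F x - G x)"
proof -
  assume F: "bounded_rv F" and G: "bounded_rv G"
  obtain C D where "\<And>x. norm (F x) \<le> C" "\<And>x. norm (G x) \<le> D"
    using F G unfolding bounded_rv_def by blast
  then have "norm (F x - G x) \<le> C + D" for x
    by (intro order.trans[OF norm_triangle_ineq4] add_mono)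
  moreover have "(\<lambda>x. F x - G x) \<in> borel_measurable M"
    using F G unfolding bounded_rv_def by (intro borel_measurable_diff) auto
  ultimately show ?thesis unfolding bounded_rv_def by blast
qed

lemma bounded_rv_mult:
  assumes "bounded_rv F" "bounded_rv G" shows "bounded_rv (\<lambda>x. F x * G x)"
proof -
  obtain C D where "\<And>x. norm (F x) \<le> C" "\<And>x. norm (G x) \<le> D"
    using assms unfolding bounded_rv_def by blast
  then have "norm (F x * G x) \<le> C * D" for x
    unfolding norm_mult by (intro mult_mono norm_ge_zero) (auto intro: order.trans[OF norm_ge_zero])
  moreover have "(\<lambda>x. F x * G x) \<in> borel_measurable M"
    using assms unfolding bounded_rv_def by (intro borel_measurable_times) auto
  ultimately show ?thesis unfolding bounded_rv_def by blast
qed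

lemma bounded_rv_shift: "bounded_rv F \<Longrightarrow> bounded_rv (\<lambda>x. F (shift m x))"
  unfolding bounded_rv_def using measurable_compose[OF shift_measurable_M] by blast

lemma bounded_rv_indicator: "A \<in> sets M \<Longrightarrow> bounded_rv (indicator A)"
  unfolding bounded_rv_def by (auto simp: indicator_def intro!: exI[of _ 1])

lemma bounded_rv_trig: "F \<in> trig \<Longrightarrow> bounded_rv F"
  unfolding bounded_rv_def using trig_bounded borel_measurable_M[OF trig_measurable] by blast

lemma integral_norm_shift: "bounded_rv F \<Longrightarrow> (LINT x|M. norm (F (shift m x))) = (LINT x|M. norm (F x))"
proof -
  assume "bounded_rv F"
  then have [measurable]: "F \<in> borel_measurable M" by (simp add: bounded_rv_def)
  show ?thesis by (rule integral_shift) measurable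
qed

lemma correlation_diff_left:
  assumes "bounded_rv F" "bounded_rv F'" "bounded_rv G"
  shows "correlation (\<lambda>x. F x - F' x) G m = correlation F G m - correlation F' G m"
  unfolding correlation_def using assms
  by (simp add: left_diff_distrib bounded_rv_integrable bounded_rv_mult bounded_rv_shift)

lemma correlation_diff_right:
  assumes "bounded_rv F" "bounded_rv G" "bounded_rv G'"
  shows "correlation F (\<lambda>x. G x - G' x) m = correlation F G m - correlation F G' m"
  unfolding correlation_def using assms
  by (simp add: right_diff_distrib bounded_rv_integrable bounded_rv_mult bounded_rv_shift)

text \<open>Correlation is continuous in the mean norm of one argument while the other stays
  bounded; the factor 2 counts the mixed term and the product of means. Both positions occur, since
  two indicators are replaced in turn.\<close>

lemma norm_correlation_le:
  assumes F: "bounded_rv F" and G: "bounded_rv G" and C: "\<And>x. norm (G x) \<le> C"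
  shows "norm (correlation F G m) \<le> 2 * C * (LINT x|M. norm (F x))"
    and "norm (correlation G F m) \<le> 2 * C * (LINT x|M. norm (F x))"
proof -
  have bound: "norm (CLINT x|M. U x * V x) \<le> C * (LINT x|M. norm (U x))"
    if U: "bounded_rv U" and V: "bounded_rv V" and C: "\<And>x. norm (V x) \<le> C" for U V C
  proof -
    have "norm (CLINT x|M. U x * V x) \<le> (LINT x|M. norm (U x * V x))"
      by (rule integral_norm_bound)
    also have "\<dots> \<le> (LINT x|M. C * norm (U x))"
      using U V C by (intro integral_mono integrable_norm integrable_mult_right bounded_rv_integrable bounded_rv_mult)
        (auto simp: norm_mult mult.commute[of C] intro: mult_left_mono)
    finally show ?thesis by simp
  qed
  have 1: "bounded_rv (\<lambda>x. 1)" unfolding bounded_rv_def by auto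
  have "norm ((CLINT x|M. F x) * (CLINT x|M. G x)) \<le> (LINT x|M. norm (F x)) * C"
    unfolding norm_mult
  proof (intro mult_mono)
    show "norm (CLINT x|M. F x) \<le> (LINT x|M. norm (F x))" by (rule integral_norm_bound)
    have "norm (CLINT x|M. 1 * G x) \<le> C * (LINT x|M. norm (1::complex))" by (rule bound[OF 1 G C])
    then show "norm (CLINT x|M. G x) \<le> C" by (simp add: prob_space)
  qed auto
  moreover have "norm (CLINT x|M. F (shift m x) * G x) \<le> C * (LINT x|M. norm (F x))"
    using bound[OF bounded_rv_shift[OF F] G C] by (simp add: integral_norm_shift[OF F])
  moreover have "norm (CLINT x|M. G (shift m x) * F x) \<le> C * (LINT x|M. norm (F x))"
    using bound[OF F bounded_rv_shift[OF G] C] by (simp add: mult.commute)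
  ultimately show "norm (correlation F G m) \<le> 2 * C * (LINT x|M. norm (F x))"
    "norm (correlation G F m) \<le> 2 * C * (LINT x|M. norm (F x))"
    unfolding correlation_def
    using norm_triangle_ineq4[of "CLINT x|M. F (shift m x) * G x" "(CLINT x|M. F x) * (CLINT x|M. G x)"]
      norm_triangle_ineq4[of "CLINT x|M. G (shift m x) * F x" "(CLINT x|M. G x) * (CLINT x|M. F x)"]
    by (simp_all add: mult.commute)
qed

lemma null_mean_sets:
  assumes mix: "\<And>c. null_mean (\<lambda>j. r (int j + c))" and A: "A \<in> sets M" and B: "B \<in> sets M"
  shows "null_mean (\<lambda>j. norm (correlation (indicator A) (indicator B) (int j)))"
proof (rule null_mean_approx)
  fix e :: real assume "0 < e"
  note iA = bounded_rv_indicator[OF A] and iB = bounded_rv_indicator[OF B]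
  obtain F where F: "F \<in> trig" "(LINT x|M. norm (indicator A x - F x)) < e / 4"
    using trig_L1_dense[OF prob_space_axioms sets_M, of A "e / 4"] A sets_M \<open>0 < e\<close> by auto
  obtain C0 where C0: "\<And>x. norm (F x) \<le> C0" using trig_bounded[OF F(1)] by blast
  define C where "C = max C0 1"
  have C: "C > 0" "\<And>x. norm (F x) \<le> C" using C0 by (auto simp: C_def le_max_iff_disj)
  \<comment> \<open>The error made on \<open>B\<close> is tested against \<open>F\<close> rather
    than against an indicator, so its tolerance depends on the bound \<open>C\<close> of
    \<open>F\<close>, which must be chosen before.\<close>
  obtain G where G: "G \<in> trig" "(LINT x|M. norm (indicator B x - G x)) < e / (4 * C)"
    using trig_L1_dense[OF prob_space_axioms sets_M, of B "e / (4 * C)"] B sets_M \<open>0 < e\<close> C by auto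
  note F' = bounded_rv_trig[OF F(1)] and G' = bounded_rv_trig[OF G(1)]
  have "norm (correlation (indicator A) (indicator B) m) \<le> norm (correlation F G m) + e" for m
  proof -
    have eq: "correlation (indicator A) (indicator B) m = correlation (\<lambda>x. indicator A x - F x) (indicator B) m
        + correlation F (\<lambda>x. indicator B x - G x) m + correlation F G m"
      by (simp add: correlation_diff_left[OF iA F' iB] correlation_diff_right[OF F' iB G'])
    have "norm (correlation (\<lambda>x. indicator A x - F x) (indicator B) m) \<le> 2 * 1 * (LINT x|M. norm (indicator A x - F x))"
      by (rule norm_correlation_le(1)[OF bounded_rv_diff[OF iA F'] iB]) (simp add: indicator_def)
    also have "\<dots> \<le> e / 2" using F(2) by simp
    finally have 1: "norm (correlation (\<lambda>x. indicator A x - F x) (indicator B) m) \<le> e / 2" .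
    have "norm (correlation F (\<lambda>x. indicator B x - G x) m) \<le> 2 * C * (LINT x|M. norm (indicator B x - G x))"
      by (rule norm_correlation_le(2)[OF bounded_rv_diff[OF iB G'] F' C(2)])
    also have "\<dots> \<le> 2 * C * (e / (4 * C))" using G(2) C by (intro mult_left_mono) auto
    also have "\<dots> = e / 2" using C by simp
    finally have 2: "norm (correlation F (\<lambda>x. indicator B x - G x) m) \<le> e / 2" .
    show ?thesis
      unfolding eq using 1 2 by (intro order.trans[OF norm_triangle_ineq] order.trans[OF add_right_mono[OF norm_triangle_ineq]]) simp
  qed
  then show "\<exists>b. null_mean b \<and> (\<forall>j. \<bar>norm (correlation (indicator A) (indicator B) (int j))\<bar> \<le> \<bar>b j\<bar> + e)"
    using null_mean_trig[OF mix F(1) G(1)] by (intro exI[of _ "\<lambda>j. norm (correlation F G (int j))"]) simp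
qed

lemma integral_indicator_complex: "A \<in> sets M \<Longrightarrow> (CLINT x|M. indicator A x) = of_real (measure M A)"
proof -
  assume A: "A \<in> sets M"
  have "(CLINT x|M. indicator A x) = (CLINT x|M. of_real (indicator A x))"
    by (intro Bochner_Integration.integral_cong) (auto simp: indicator_def)
  then show ?thesis using A by simp
qed

lemma weakly_mixing_shift:
  assumes mix: "\<And>c. null_mean (\<lambda>j. r (int j + c))"
  shows "weakly_mixing M (shift 1)"
  unfolding weakly_mixing_def
proof (intro ballI)
  fix A B assume A: "A \<in> sets M" and B: "B \<in> sets M"
  have "\<bar>measure M ((shift 1 ^^ j) -` A \<inter> B) - measure M A * measure M B\<bar>
      = norm (correlation (indicator A) (indicator B) (int j))" for j
  proof -
    have vimage: "(shift 1 ^^ j) -` A = shift (int j) -` A \<inter> space M"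
      by (auto simp: funpow_shift space_M)
    then have "(shift 1 ^^ j) -` A \<inter> B \<in> sets M"
      using measurable_sets[OF shift_measurable_M A] B by auto
    moreover have "indicator A (shift (int j) x) * indicator B x = (indicator ((shift 1 ^^ j) -` A \<inter> B) x :: complex)" for x
      by (auto simp: indicator_def funpow_shift)
    ultimately have "correlation (indicator A) (indicator B) (int j) =
        of_real (measure M ((shift 1 ^^ j) -` A \<inter> B) - measure M A * measure M B)"
      unfolding correlation_def by (simp add: integral_indicator_complex A B)
    then show ?thesis by (simp only: norm_of_real)
  qed
  then show "(\<lambda>N. (\<Sum>j<N. \<bar>measure M ((shift 1 ^^ j) -` A \<inter> B) - measure M A * measure M B\<bar>) / real N) \<longlonglongrightarrow> 0"
    using null_mean_sets[OF mix A B] by (simp add: null_mean_def)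
qed

text \<open>The approximation error occurs at the point and at its shift; invariance of the measure
  makes the two contributions equal, whence the tolerance \<open>e / 4\<close>.\<close>

lemma rigid_sets:
  assumes rig: "(\<lambda>k. r (n k)) \<longlonglongrightarrow> 1" and A: "A \<in> sets M"
  shows "(\<lambda>k. LINT x|M. norm (indicator A (shift (n k) x) - indicator A x :: complex)) \<longlonglongrightarrow> 0"
proof (rule LIMSEQ_I)
  fix e :: real assume "0 < e"
  note iA = bounded_rv_indicator[OF A]
  obtain F where F: "F \<in> trig" "(LINT x|M. norm (indicator A x - F x)) < e / 4"
    using trig_L1_dense[OF prob_space_axioms sets_M, of A "e / 4"] A sets_M \<open>0 < e\<close> by auto
  note F' = bounded_rv_trig[OF F(1)]
  have le: "(LINT x|M. norm (indicator A (shift m x) - indicator A x :: complex)) \<le>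
     2 * (LINT x|M. norm (indicator A x - F x)) + (LINT x|M. norm (F (shift m x) - F x))" for m
  proof -
    define U where "U x = indicator A x - F x" for x
    have U: "bounded_rv U" unfolding U_def by (rule bounded_rv_diff[OF iA F'])
    have int: "integrable M (\<lambda>x. norm (U x))" "integrable M (\<lambda>x. norm (U (shift m x)))"
       "integrable M (\<lambda>x. norm (F (shift m x) - F x))"
       "integrable M (\<lambda>x. norm (indicator A (shift m x) - indicator A x :: complex))"
      using U F' iA by (auto intro!: integrable_norm bounded_rv_integrable bounded_rv_diff bounded_rv_shift[of F] bounded_rv_shift[of U] bounded_rv_shift[of "indicator A"])
    have "(LINT x|M. norm (indicator A (shift m x) - indicator A x :: complex)) \<le>
      (LINT x|M. norm (U (shift m x)) + norm (F (shift m x) - F x) + norm (U x))"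
    proof (rule integral_mono)
      fix x
      have eq: "(indicator A (shift m x) - indicator A x :: complex) = (U (shift m x) + (F (shift m x) - F x)) - U x"
        by (simp add: U_def)
      show "norm (indicator A (shift m x) - indicator A x :: complex) \<le> norm (U (shift m x)) + norm (F (shift m x) - F x) + norm (U x)"
        unfolding eq by (rule order.trans[OF norm_triangle_ineq4 add_right_mono[OF norm_triangle_ineq]])
    qed (intro Bochner_Integration.integrable_add int)+
    also have "\<dots> = 2 * (LINT x|M. norm (U x)) + (LINT x|M. norm (F (shift m x) - F x))"
      using int by (simp add: integral_norm_shift[OF U])
    finally show ?thesis unfolding U_def .
  qed
  obtain K where K: "\<And>k. k \<ge> K \<Longrightarrow> (LINT x|M. norm (F (shift (n k) x) - F x)) < e / 2"
    using order_tendstoD(2)[OF rigid_trig[OF rig F(1)], of "e / 2"] \<open>0 < e\<close> unfolding eventually_sequentially by auto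
  have "norm ((LINT x|M. norm (indicator A (shift (n k) x) - indicator A x :: complex)) - 0) < e" if "k \<ge> K" for k
  proof -
    have "(LINT x|M. norm (indicator A (shift (n k) x) - indicator A x :: complex)) < e"
      using le[of "n k"] F(2) K[OF that] by linarith
    then show ?thesis by simp
  qed
  then show "\<exists>K. \<forall>k\<ge>K. norm ((LINT x|M. norm (indicator A (shift (n k) x) - indicator A x :: complex)) - 0) < e"
    by blast
qed

text \<open>The increments of \<open>s\<close> are bounded by \<open>C\<close>, so their squares are
  at most \<open>C\<close> times a combination of the increments of the indicators of level sets,
  and convergence in mean upgrades to mean square.\<close>

lemma rigid_simple:
  fixes s :: "(nat \<Rightarrow> real) \<Rightarrow> complex"
  assumes rig: "(\<lambda>k. r (n k)) \<longlonglongrightarrow> 1" and s: "simple_function M s"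
  shows "(\<lambda>k. LINT x|M. (norm (s (shift (n k) x) - s x))\<^sup>2) \<longlonglongrightarrow> 0"
proof -
  define R where "R = range s"
  define A where "A y = s -` {y}" for y
  have fin: "finite R" using s by (simp add: R_def simple_function_def space_M)
  have A: "A y \<in> sets M" if "y \<in> R" for y
    using s that by (auto simp: R_def A_def simple_function_def space_M)
  define V where "V m y x = norm (indicator (A y) (shift m x) - indicator (A y) x :: complex)" for m y x
  have V: "integrable M (V m y)" if "y \<in> R" for m y
    unfolding V_def by (intro integrable_norm bounded_rv_integrable bounded_rv_diff bounded_rv_shift bounded_rv_indicator A that)
  have rep: "s x = (\<Sum>y\<in>R. y * indicator (A y) x)" for x
  proof -
    have "(\<Sum>y\<in>R. y * indicator (A y) x) = (\<Sum>y\<in>R. if y = s x then y else 0)"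
      by (intro sum.cong) (auto simp: A_def indicator_def)
    then show ?thesis using fin by (simp add: R_def sum.delta)
  qed
  define C where "C = (\<Sum>y\<in>R. norm y)"
  have diff: "norm (s (shift m x) - s x) \<le> (\<Sum>y\<in>R. norm y * V m y x)" for m x
  proof -
    have "s (shift m x) - s x = (\<Sum>y\<in>R. y * (indicator (A y) (shift m x) - indicator (A y) x))"
      unfolding rep[of x] rep[of "shift m x"] sum_subtractf[symmetric] right_diff_distrib ..
    then show ?thesis unfolding V_def norm_mult[symmetric] by (simp only: norm_sum)
  qed
  have "V m y x \<le> 1" for m y x by (simp add: V_def indicator_def)
  then have "(\<Sum>y\<in>R. norm y * V m y x) \<le> C" for m x
    unfolding C_def by (intro sum_mono) (simp add: mult_left_le)
  then have "norm (s (shift m x) - s x) \<le> C" for m x using diff order.trans by blast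
  then have sq: "(norm (s (shift m x) - s x))\<^sup>2 \<le> C * (\<Sum>y\<in>R. norm y * V m y x)" for m x
    unfolding power2_eq_square by (intro mult_mono diff) (auto intro: order.trans[OF norm_ge_zero])
  have int: "integrable M (\<lambda>x. C * (\<Sum>y\<in>R. norm y * V m y x))" for m
    by (intro integrable_mult_right Bochner_Integration.integrable_sum V)
  show ?thesis
  proof (rule tendsto_sandwich[OF _ _ tendsto_const[of 0]])
    show "\<forall>\<^sub>F k in sequentially. (LINT x|M. (norm (s (shift (n k) x) - s x))\<^sup>2) \<le> (LINT x|M. C * (\<Sum>y\<in>R. norm y * V (n k) y x))"
      by (intro always_eventually allI integral_mono' int sq order.trans[OF zero_le_power2 sq])
    have eq: "(LINT x|M. C * (\<Sum>y\<in>R. norm y * V m y x)) = C * (\<Sum>y\<in>R. norm y * (LINT x|M. V m y x))" for m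
      by (simp add: V integral_sum)
    have "(\<lambda>k. C * (\<Sum>y\<in>R. norm y * (LINT x|M. V (n k) y x))) \<longlonglongrightarrow> C * (\<Sum>y\<in>R. norm y * 0)"
      unfolding V_def by (intro tendsto_intros rigid_sets rig A)
    then show "(\<lambda>k. LINT x|M. C * (\<Sum>y\<in>R. norm y * V (n k) y x)) \<longlonglongrightarrow> 0"
      unfolding eq by simp
  qed simp
qed

lemma simple_L2_dense:
  assumes "f \<in> L2_fun M" and "0 < e"
  obtains s where "simple_function M s" "integrable M (\<lambda>x. (norm (f x - s x))\<^sup>2)"
    "(LINT x|M. (norm (f x - s x))\<^sup>2) < e"
proof -
  have [measurable]: "f \<in> borel_measurable M" and f: "integrable M (\<lambda>x. (cmod (f x))\<^sup>2)"
    using assms(1) by (auto simp: L2_fun_def)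
  obtain s where s: "\<And>i. simple_function M (s i)" "\<And>x. x \<in> space M \<Longrightarrow> (\<lambda>i. s i x) \<longlonglongrightarrow> f x"
     "\<And>i x. x \<in> space M \<Longrightarrow> dist (s i x) 0 \<le> 2 * dist (f x) 0"
    using borel_measurable_implies_sequence_metric[of f M 0] by (metis \<open>f \<in> borel_measurable M\<close>)
  have [measurable]: "s i \<in> borel_measurable M" for i using borel_measurable_simple_function[OF s(1)] .
  \<comment> \<open>The approximants have modulus at most twice that of \<open>f\<close>, hence the
    difference at most three times.\<close>
  have bound: "(norm (f x - s i x))\<^sup>2 \<le> 9 * (norm (f x))\<^sup>2" for i x
  proof -
    have "norm (f x - s i x) \<le> 3 * norm (f x)"
      using norm_triangle_ineq4[of "f x" "s i x"] s(3)[of x i] by (simp add: space_M)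
    then have "(norm (f x - s i x))\<^sup>2 \<le> (3 * norm (f x))\<^sup>2" by (rule power_mono) simp
    then show ?thesis by (simp add: power_mult_distrib)
  qed
  have "(\<lambda>i. LINT x|M. (norm (f x - s i x))\<^sup>2) \<longlonglongrightarrow> (LINT x|M. 0)"
  proof (rule integral_dominated_convergence[where w="\<lambda>x. 9 * (norm (f x))\<^sup>2"])
    show "AE x in M. (\<lambda>i. (norm (f x - s i x))\<^sup>2) \<longlonglongrightarrow> 0"
    proof (intro always_eventually allI)
      fix x
      have "(\<lambda>i. (norm (f x - s i x))\<^sup>2) \<longlonglongrightarrow> (norm (f x - f x))\<^sup>2"
        by (intro tendsto_intros s(2)) (simp add: space_M)
      then show "(\<lambda>i. (norm (f x - s i x))\<^sup>2) \<longlonglongrightarrow> 0" by simp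
    qed
  qed (use f bound in auto)
  then have "(\<lambda>i. LINT x|M. (norm (f x - s i x))\<^sup>2) \<longlonglongrightarrow> 0" by simp
  from eventually_happens'[OF sequentially_bot order_tendstoD(2)[OF this \<open>0 < e\<close>]]
  obtain i where i: "(LINT x|M. (norm (f x - s i x))\<^sup>2) < e" by blast
  have "integrable M (\<lambda>x. (norm (f x - s i x))\<^sup>2)"
    by (rule Bochner_Integration.integrable_bound[of _ "\<lambda>x. 9 * (norm (f x))\<^sup>2"]) (use f bound in auto)
  then show thesis using that s(1) i by blast
qed

text \<open>The increment of \<open>f\<close> splits into three differences, and the square of a sum
  of three is at most 3 times the sum of squares. Two of the integrals agree by invariance, which
  gives the constants 6 and 3 and the tolerances \<open>e / 12\<close> and
  \<open>e / 6\<close>.\<close>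

lemma rigid_L2:
  assumes rig: "(\<lambda>k. r (n k)) \<longlonglongrightarrow> 1" and f: "f \<in> L2_fun M"
  shows "(\<lambda>k. LINT x|M. (norm (f (shift (n k) x) - f x))\<^sup>2) \<longlonglongrightarrow> 0"
proof (rule LIMSEQ_I)
  fix e :: real assume "0 < e"
  then obtain s where s: "simple_function M s" "integrable M (\<lambda>x. (norm (f x - s x))\<^sup>2)"
    "(LINT x|M. (norm (f x - s x))\<^sup>2) < e / 12"
    using simple_L2_dense[OF f, of "e / 12"] by auto
  have [measurable]: "f \<in> borel_measurable M" "s \<in> borel_measurable M"
    using f borel_measurable_simple_function[OF s(1)] by (auto simp: L2_fun_def)
  have "finite (range s)" using s(1) by (simp add: simple_function_def space_M)
  then obtain C where C: "\<And>x. norm (s x) \<le> C"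
    using finite_imp_bounded[of "range s"] by (auto simp: bounded_iff)
  have s': "bounded_rv s" unfolding bounded_rv_def using C by auto
  have int_s: "integrable M (\<lambda>x. (norm (s (shift m x) - s x))\<^sup>2)" for m
  proof -
    have d: "bounded_rv (\<lambda>x. s (shift m x) - s x)" by (intro bounded_rv_diff bounded_rv_shift s')
    show ?thesis
      using integrable_norm[OF bounded_rv_integrable[OF bounded_rv_mult[OF d d]]] by (simp add: norm_mult power2_eq_square)
  qed
  have le: "(LINT x|M. (norm (f (shift m x) - f x))\<^sup>2) \<le> 6 * (LINT x|M. (norm (f x - s x))\<^sup>2) + 3 * (LINT x|M. (norm (s (shift m x) - s x))\<^sup>2)" for m
  proof -
    have int: "integrable M (\<lambda>x. (norm (f (shift m x) - s (shift m x)))\<^sup>2)"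
      by (rule integrable_shift[OF s(2)])
    have eq: "(LINT x|M. (norm (f (shift m x) - s (shift m x)))\<^sup>2) = (LINT x|M. (norm (f x - s x))\<^sup>2)"
      by (rule integral_shift) measurable
    have "(LINT x|M. (norm (f (shift m x) - f x))\<^sup>2) \<le> (LINT x|M. 3 * (norm (f (shift m x) - s (shift m x)))\<^sup>2
        + 3 * (norm (s (shift m x) - s x))\<^sup>2 + 3 * (norm (f x - s x))\<^sup>2)"
    proof (rule integral_mono')
      fix x
      define a b c where "a = norm (f (shift m x) - s (shift m x))" and "b = norm (s (shift m x) - s x)" and "c = norm (f x - s x)"
      have eq: "f (shift m x) - f x = ((f (shift m x) - s (shift m x)) + (s (shift m x) - s x)) - (f x - s x)" by simp
      have "norm (f (shift m x) - f x) \<le> a + b + c"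
        unfolding eq a_def b_def c_def by (rule order.trans[OF norm_triangle_ineq4 add_right_mono[OF norm_triangle_ineq]])
      then have "(norm (f (shift m x) - f x))\<^sup>2 \<le> (a + b + c)\<^sup>2" by (rule power_mono) simp
      also have "\<dots> = 3 * a\<^sup>2 + 3 * b\<^sup>2 + 3 * c\<^sup>2 - ((a - b)\<^sup>2 + (b - c)\<^sup>2 + (a - c)\<^sup>2)"
        by (simp add: power2_eq_square algebra_simps)
      also have "\<dots> \<le> 3 * a\<^sup>2 + 3 * b\<^sup>2 + 3 * c\<^sup>2"
        using zero_le_power2[of "a - b"] zero_le_power2[of "b - c"] zero_le_power2[of "a - c"] by linarith
      finally show "(norm (f (shift m x) - f x))\<^sup>2 \<le> 3 * (norm (f (shift m x) - s (shift m x)))\<^sup>2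
        + 3 * (norm (s (shift m x) - s x))\<^sup>2 + 3 * (norm (f x - s x))\<^sup>2" by (simp add: a_def b_def c_def)
    qed (intro Bochner_Integration.integrable_add integrable_mult_right int int_s s(2), simp)
    also have "\<dots> = 6 * (LINT x|M. (norm (f x - s x))\<^sup>2) + 3 * (LINT x|M. (norm (s (shift m x) - s x))\<^sup>2)"
      using int int_s s(2) eq by simp
    finally show ?thesis .
  qed
  obtain K where K: "\<And>k. k \<ge> K \<Longrightarrow> (LINT x|M. (norm (s (shift (n k) x) - s x))\<^sup>2) < e / 6"
    using order_tendstoD(2)[OF rigid_simple[OF rig s(1)], of "e / 6"] \<open>0 < e\<close> unfolding eventually_sequentially by auto
  have "norm ((LINT x|M. (norm (f (shift (n k) x) - f x))\<^sup>2) - 0) < e" if "k \<ge> K" for k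
  proof -
    have "(LINT x|M. (norm (f (shift (n k) x) - f x))\<^sup>2) < e"
      using le[of "n k"] s(3) K[OF that] by linarith
    then show ?thesis by simp
  qed
  then show "\<exists>K. \<forall>k\<ge>K. norm ((LINT x|M. (norm (f (shift (n k) x) - f x))\<^sup>2) - 0) < e" by blast
qed

lemma rigid_wrt_shift:
  assumes rig: "(\<lambda>k. r (n k)) \<longlonglongrightarrow> 1"
  shows "rigid_wrt M (shift 1) n"
  unfolding rigid_wrt_def
proof
  fix f assume f: "f \<in> L2_fun M"
  have "iter_int (koopman (shift 1)) m f x = f (shift m x)" for m x
    by (simp add: iter_int_koopman[OF bij_shift] iter_int_shift)
  then show "(\<lambda>k. L2_norm M (\<lambda>x. iter_int (koopman (shift 1)) (n k) f x - f x)) \<longlonglongrightarrow> 0"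
    using tendsto_real_sqrt[OF rigid_L2[OF rig f]] by (simp add: L2_norm_def)
qed

section \<open>Nontriviality of the Gaussian system\<close>

lemma distr_coord: "distr M borel (\<lambda>x. x 0) = std_normal_distribution"
proof (rule Levy_uniqueness)
  have [measurable]: "(\<lambda>x. x 0) \<in> borel_measurable M"
    by (rule borel_measurable_M[OF fin_lin_measurable[OF fin_lin.coord]])
  show "real_distribution (distr M borel (\<lambda>x. x 0))" by (rule real_distribution_distr) measurable
  show "real_distribution std_normal_distribution" by (rule real_dist_normal_dist)
  show "char (distr M borel (\<lambda>x. x 0)) = char std_normal_distribution"
  proof
    fix t
    have "char (distr M borel (\<lambda>x. x 0)) t = (CLINT x|M. iexp (t * x 0))"
      unfolding char_def by (subst integral_distr) auto
    also have "\<dots> = exp (- (LINT x|M. (t * x 0)\<^sup>2) / 2)"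
      by (rule char_fin_lin[OF fin_lin.scale[OF fin_lin.coord]])
    also have "(LINT x|M. (t * x 0)\<^sup>2) = t\<^sup>2"
      unfolding power_mult_distrib using cov_coord[of 0 0] by (simp add: power2_eq_square r_0)
    finally show "char (distr M borel (\<lambda>x. x 0)) t = char std_normal_distribution t"
      by (simp add: char_std_normal_distribution)
  qed
qed

text \<open>The normal density is positive everywhere, so its null sets are Lebesgue null, and a set
  containing an interval is not.\<close>

lemma coord_positive_measure:
  assumes A: "A \<in> sets borel" and "{a<..<b} \<subseteq> A" "a < b"
  shows "0 < measure M {x. x 0 \<in> A}"
proof -
  have [measurable]: "(\<lambda>x. x 0) \<in> borel_measurable M"
    by (rule borel_measurable_M[OF fin_lin_measurable[OF fin_lin.coord]])
  have "{a<..<b} \<notin> null_sets lborel" using \<open>a < b\<close> by (simp add: null_sets_def)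
  then have "A \<notin> null_sets lborel" using null_sets_subset[of A lborel "{a<..<b}"] assms by auto
  have "A \<notin> null_sets std_normal_distribution"
  proof
    assume "A \<in> null_sets std_normal_distribution"
    then have "AE x in lborel. x \<in> A \<longrightarrow> std_normal_density x \<le> 0"
      by (subst (asm) null_sets_density_iff) (auto simp: ennreal_eq_0_iff)
    then have "AE x in lborel. x \<notin> A"
    proof eventually_elim
      case (elim x)
      have "std_normal_density x > 0" by (rule normal_density_pos) simp
      then show ?case using elim by auto
    qed
    then have "A \<in> null_sets lborel" using AE_iff_null_sets[of A lborel] A by simp
    then show False using \<open>A \<notin> null_sets lborel\<close> by simp
  qed
  then have "emeasure (distr M borel (\<lambda>x. x 0)) A \<noteq> 0"
    unfolding distr_coord using A by (simp add: null_sets_def)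
  then have "emeasure M {x. x 0 \<in> A} \<noteq> 0"
    using A by (simp add: emeasure_distr space_M vimage_def)
  then show ?thesis by (simp add: emeasure_eq_measure zero_less_measure_iff)
qed

lemma measure_preserving_shift: "measure_preserving_system M (shift 1)"
proof
  show "sets M = sets borel" by (rule sets_M)
  show "bij (shift 1)" by (rule bij_shift)
  show "shift 1 \<in> measurable M M" by measurable
  show "inv (shift 1) \<in> measurable M M" unfolding inv_shift by measurable
  show "distr M M (shift 1) = M" by (rule distr_shift)
  have [measurable]: "(\<lambda>x. x 0) \<in> borel_measurable M"
    by (rule borel_measurable_M[OF fin_lin_measurable[OF fin_lin.coord]])
  \<comment> \<open>A half-space and its complement both have positive measure, so the space is not
    reduced to one atom.\<close>
  define A where "A = {x :: nat \<Rightarrow> real. x 0 \<in> {0<..}}"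
  have "A = (\<lambda>x. x 0) -` {0<..} \<inter> space M" by (auto simp: A_def space_M)
  then have A: "A \<in> sets M" by simp
  have "0 < measure M A" unfolding A_def by (rule coord_positive_measure[of _ 0 1]) auto
  moreover have "0 < measure M {x. x 0 \<in> {..0}}" by (rule coord_positive_measure[of _ "-1" 0]) auto
  moreover have "{x. x 0 \<in> {..0::real}} = space M - A" by (auto simp: A_def space_M)
  ultimately have "0 < measure M A" "measure M A < 1" using prob_compl[OF A] by auto
  then show "\<exists>A\<in>sets M. 0 < measure M A \<and> measure M A < 1" using A by blast
qed

end

theorem corollary2p5:
  fixes n :: "nat \<Rightarrow> int"
  assumes "strict_mono n"
    and "sphere (0::complex) 1 \<subseteq> closure {z \<in> sphere 0 1. (\<lambda>k. z powi n k) \<longlonglongrightarrow> 1}"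
  shows "rigidity_sequence (\<lambda>k. n (Suc k))"
proof (rule exists_correlation[OF assms(2)], goal_cases)
  case (1 r)
  note r_0 = 1(1) and r_minus = 1(2) and r_pos = 1(3) and r_mix = 1(4) and r_rig = 1(5)
  \<comment> \<open>The process is indexed by integers and the sequence space by naturals; decoding
    is a bijection, so positivity passes over by reindexing.\<close>
  define K where "K a b = r (int_decode a - int_decode b)" for a b
  have "0 \<le> (\<Sum>a\<in>A. \<Sum>b\<in>A. t a * t b * K a b)" if "finite A" for A t
    using r_pos[of "int_decode ` A" "\<lambda>z. t (int_encode z)"] that
    by (simp add: sum.reindex inj_on_def K_def int_decode_eq)
  moreover have "K a b = K b a" for a b
    using r_minus[of "int_decode a - int_decode b"] by (simp add: K_def)
  ultimately have "psd_kernel K" unfolding psd_kernel_def by blast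
  from exists_gaussian_measure[OF this] obtain M :: "(nat \<Rightarrow> real) measure"
    where M: "prob_space M" "sets M = sets borel"
      "\<And>a b. integrable M (\<lambda>x. x a * x b)" "\<And>a b. (LINT x|M. x a * x b) = K a b"
      "\<And>f. f \<in> fin_lin \<Longrightarrow> (CLINT x|M. iexp (f x)) = exp (- (LINT x|M. (f x)\<^sup>2) / 2)"
    by blast
  interpret M: prob_space M by fact
  interpret gaussian_shift M r
    by unfold_locales (use M r_0 in \<open>simp_all add: K_def\<close>)
  have "measure_preserving_system M (shift 1)" by (rule measure_preserving_shift)
  moreover have "weakly_mixing M (shift 1)"
    by (rule weakly_mixing_shift) (simp add: null_mean_def r_mix)
  \<comment> \<open>The hypothesis starts at index 0 and the conclusion at index 1; dropping one
    term does not affect the limit.\<close>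
  moreover have "rigid_wrt M (shift 1) (\<lambda>k. n (Suc k))"
    by (rule rigid_wrt_shift[OF LIMSEQ_Suc[OF r_rig]])
  moreover have "strict_mono (\<lambda>k. n (Suc k))"
    using assms(1) by (simp add: strict_mono_def)
  ultimately show ?thesis unfolding rigidity_sequence_def by blast
qed

end
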